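(* Let $V$ and $W$ be varieties in $\mathbb{B}_d$, $1\le d\le\infty$. Suppose that $\phi:\mathcal{M}_V\to\mathcal{M}_W$ is an algebra isomorphism induced by a biholomorphism $F:W\to V$, that is, $\phi(h)=h\circ F$ for all $h\in\mathcal{M}_V$. Then there are constants $c,C>0$ such that \[ c\,\delta(\lambda,\mu)\le \delta(F(\lambda),F(\mu))\le C\,\delta(\lambda,\mu)\quad\text{for all }\lambda,\mu\in W, \] where $\delta$ denotes the pseudohyperbolic distance on $\mathbb{B}_d$.
   Context: $\mathbb{B}_d$ is the open unit ball of $\mathbb{C}^d$ (of $\ell^2$ if $d=\infty$). The Drury-Arveson space $\mathcal{H}_d$ is the reproducing kernel Hilbert space on $\mathbb{B}_d$ with kernel $k(x,y)=\frac{1}{1-\langle x,y\rangle}$, $k_y(x)=k(x,y)$, and $\mathcal{M}_d$ is its multiplier algebra. A variety in $\mathbb{B}_d$ is a set of the form $\bigcap_{i} \{x\in\mathbb{B}_d: h_i(x)=0\}$ for a family $\{h_i\}\subset\mathcal{M}_d$. For a variety $V$, $\mathcal{H}_V=\overline{\operatorname{span}}\{k_y:y\in V\}$, considered as a Hilbert space of functions on $V$, and $\mathcal{M}_V$ is its multiplier algebra (functions on $V$). A map on a subset $W$ of $\mathbb{C}^d$ (or $\ell^2$) is holomorphic if near each point of $W$ it is the restriction of a holomorphic map on a ball about that point; a biholomorphism is a bijection that is holomorphic with holomorphic inverse. The pseudohyperbolic distance on $\mathbb{B}_d$ is $\delta(z,w)=\|\phi_w(z)\|$, where $\phi_w$ is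 the conformal automorphism of $\mathbb{B}_d$ interchanging $w$ and $0$, $\phi_w(z)=\frac{w-P_wz-(1-\|w\|^2)^{1/2}P_w^\perp z}{1-\langle z,w\rangle}$, with $P_w$ the orthogonal projection onto $\mathbb{C}w$; equivalently $\delta(z,w)^2=1-\frac{(1-\|w\|^2)(1-\|z\|^2)}{|1-\langle w,z\rangle|^2}$. *)

theory Defs
  imports "HOL-Analysis.Analysis" "HOL-Library.Countable"
begin

text \<open>
  The Hilbert space of square-summable families of complex numbers over an index type
  \<^typ>\<open>'i\<close>.  For a finite index type this is the space \<open>\<complex>\<^sup>d\<close> with \<open>d = CARD('i)\<close>, for a countably
  infinite one it is \<open>\<ell>\<^sup>2\<close>.  Since index types are nonempty, a statement about \<open>'i ell2\<close> for an
  arbitrary \<open>'i :: countable\<close> covers exactly the dimensions \<open>1 \<le> d \<le> \<infinity>\<close>.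
\<close>

typedef 'i ell2 = "{x :: 'i \<Rightarrow> complex. (\<lambda>i. (cmod (x i))\<^sup>2) summable_on UNIV}"
  morphisms coord Abs_ell2
  by (rule exI[of _ "\<lambda>_. 0"]) simp

setup_lifting type_definition_ell2

lemma coord_summable: "(\<lambda>i. (cmod (coord x i))\<^sup>2) summable_on UNIV"
  using coord[of x] by simp

lemma ell2_eqI: "(\<And>i. coord x i = coord y i) \<Longrightarrow> x = y"
  by (simp add: coord_inject[symmetric] fun_eq_iff)

lemma square_summable_scale:
  assumes "(\<lambda>i. (cmod (x i))\<^sup>2) summable_on A"
  shows "(\<lambda>i. (cmod (c * x i))\<^sup>2) summable_on A"
  using summable_on_cmult_right[OF assms, of "(cmod c)\<^sup>2"]
  by (simp add: norm_mult power_mult_distrib)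

lemma square_summable_add:
  assumes "(\<lambda>i. (cmod (x i))\<^sup>2) summable_on A" "(\<lambda>i. (cmod (y i))\<^sup>2) summable_on A"
  shows "(\<lambda>i. (cmod (x i + y i))\<^sup>2) summable_on A"
proof (rule summable_on_comparison_test)
  show "(\<lambda>i. 2 * ((cmod (x i))\<^sup>2 + (cmod (y i))\<^sup>2)) summable_on A"
    by (intro summable_on_cmult_right summable_on_add assms)
  fix i
  have "(cmod (x i + y i))\<^sup>2 \<le> (cmod (x i) + cmod (y i))\<^sup>2"
    by (intro power_mono norm_triangle_ineq) auto
  also have "\<dots> \<le> 2 * ((cmod (x i))\<^sup>2 + (cmod (y i))\<^sup>2)"
    using sum_squares_bound[of "cmod (x i)" "cmod (y i)"] by (simp add: power2_sum)
  finally show "(cmod (x i + y i))\<^sup>2 \<le> 2 * ((cmod (x i))\<^sup>2 + (cmod (y i))\<^sup>2)" .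
qed auto

lemma product_summable:
  assumes "(\<lambda>i. (cmod (x i))\<^sup>2) summable_on A" "(\<lambda>i. (cmod (y i))\<^sup>2) summable_on A"
  shows "(\<lambda>i. x i * cnj (y i)) summable_on A"
proof (rule abs_summable_summable, rule summable_on_comparison_test)
  show "(\<lambda>i. (cmod (x i))\<^sup>2 + (cmod (y i))\<^sup>2) summable_on A"
    by (intro summable_on_add assms)
  fix i
  have "2 * (cmod (x i) * cmod (y i)) \<le> (cmod (x i))\<^sup>2 + (cmod (y i))\<^sup>2"
    using sum_squares_bound[of "cmod (x i)" "cmod (y i)"] by simp
  moreover have "0 \<le> cmod (x i) * cmod (y i)" by simp
  ultimately show "cmod (x i * cnj (y i)) \<le> (cmod (x i))\<^sup>2 + (cmod (y i))\<^sup>2"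
    unfolding norm_mult complex_mod_cnj by linarith
qed auto

text \<open>The complex inner product is linear in the first argument.\<close>

definition cinner :: "'i ell2 \<Rightarrow> 'i ell2 \<Rightarrow> complex" where
  "cinner x y = (\<Sum>\<^sub>\<infinity>i. coord x i * cnj (coord y i))"

lift_definition scaleC :: "complex \<Rightarrow> 'i ell2 \<Rightarrow> 'i ell2" (infixr "*\<^sub>C" 75)
  is "\<lambda>c x i. c * x i"
  by (rule square_summable_scale)

instantiation ell2 :: (type) real_vector
begin

lift_definition zero_ell2 :: "'a ell2" is "\<lambda>_. 0"
  by simp

lift_definition plus_ell2 :: "'a ell2 \<Rightarrow> 'a ell2 \<Rightarrow> 'a ell2" is "\<lambda>x y i. x i + y i"
  by (rule square_summable_add)

lift_definition uminus_ell2 :: "'a ell2 \<Rightarrow> 'a ell2" is "\<lambda>x i. - x i"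
  by simp

lift_definition minus_ell2 :: "'a ell2 \<Rightarrow> 'a ell2 \<Rightarrow> 'a ell2" is "\<lambda>x y i. x i - y i"
  using square_summable_add[of _ _ "\<lambda>i. - _ i"] by simp

lift_definition scaleR_ell2 :: "real \<Rightarrow> 'a ell2 \<Rightarrow> 'a ell2" is "\<lambda>r x i. complex_of_real r * x i"
  by (rule square_summable_scale)

instance
  by standard (transfer; simp add: algebra_simps)+

end

instantiation ell2 :: (type) real_inner
begin

definition norm_ell2 :: "'a ell2 \<Rightarrow> real" where
  "norm_ell2 x = sqrt (\<Sum>\<^sub>\<infinity>i. (cmod (coord x i))\<^sup>2)"

definition inner_ell2 :: "'a ell2 \<Rightarrow> 'a ell2 \<Rightarrow> real" where
  "inner_ell2 x y = Re (cinner x y)"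

definition dist_ell2 :: "'a ell2 \<Rightarrow> 'a ell2 \<Rightarrow> real" where
  "dist_ell2 x y = norm (x - y)"

definition sgn_ell2 :: "'a ell2 \<Rightarrow> 'a ell2" where
  "sgn_ell2 x = inverse (norm x) *\<^sub>R x"

definition uniformity_ell2 :: "('a ell2 \<times> 'a ell2) filter" where
  "uniformity_ell2 = (INF e\<in>{0<..}. principal {(x, y). dist x y < e})"

definition open_ell2 :: "'a ell2 set \<Rightarrow> bool" where
  "open_ell2 U = (\<forall>x\<in>U. eventually (\<lambda>(x', y). x' = x \<longrightarrow> y \<in> U) uniformity)"

instance
proof
  fix x y z :: "'a ell2" and r :: real and U :: "'a ell2 set"
  have summ: "(\<lambda>i. coord u i * cnj (coord v i)) summable_on UNIV" for u v :: "'a ell2"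
    by (intro product_summable coord_summable)
  have self: "inner u u = (\<Sum>\<^sub>\<infinity>i. (cmod (coord u i))\<^sup>2)" for u :: "'a ell2"
    unfolding inner_ell2_def cinner_def
    by (subst infsum_Re[OF summ, symmetric]) (simp add: complex_mult_cnj cmod_power2)
  show "dist x y = norm (x - y)" by (rule dist_ell2_def)
  show "sgn x = x /\<^sub>R norm x" by (rule sgn_ell2_def)
  show "uniformity = (INF e\<in>{0<..}. principal {(x, y :: 'a ell2). dist x y < e})"
    by (rule uniformity_ell2_def)
  show "open U = (\<forall>x\<in>U. \<forall>\<^sub>F (x', y) in uniformity. x' = x \<longrightarrow> y \<in> U)"
    by (rule open_ell2_def)
  show "inner x y = inner y x"
  proof -
    have "cinner x y = cnj (cinner y x)"
      unfolding cinner_def infsum_cnj[symmetric] by (simp add: mult.commute)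
    then show ?thesis by (simp add: inner_ell2_def)
  qed
  show "inner (x + y) z = inner x z + inner y z"
    unfolding inner_ell2_def cinner_def plus_ell2.rep_eq distrib_right
    by (subst infsum_add[OF summ summ]) simp
  show "inner (r *\<^sub>R x) y = r * inner x y"
    unfolding inner_ell2_def cinner_def scaleR_ell2.rep_eq mult.assoc
    by (subst infsum_cmult_right[OF summ]) simp
  show "0 \<le> inner x x"
    unfolding self by (rule infsum_nonneg) simp
  show "(inner x x = 0) = (x = 0)"
  proof
    assume "inner x x = 0"
    then have "(cmod (coord x i))\<^sup>2 = 0" for i
      by (intro nonneg_infsum_le_0D[OF _ coord_summable]) (auto simp: self)
    then show "x = 0"
      by (intro ell2_eqI) (simp add: zero_ell2.rep_eq)
  qed (simp add: self zero_ell2.rep_eq)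
  show "norm x = sqrt (inner x x)"
    by (simp add: norm_ell2_def self)
qed

end

text \<open>
  Holomorphy between (possibly infinite-dimensional) spaces is Frechet differentiability with a
  complex-linear derivative; \<open>holomorphic_open\<close> is meant for open \<open>U\<close>, while \<open>holomorphic_map\<close> is
  the notion for arbitrary sets, by local extension to balls.
\<close>

definition holomorphic_open :: "('i ell2 \<Rightarrow> 'j ell2) \<Rightarrow> 'i ell2 set \<Rightarrow> bool" where
  "holomorphic_open G U \<longleftrightarrow>
     (\<forall>x\<in>U. \<exists>D. (G has_derivative D) (at x) \<and> (\<forall>c v. D (c *\<^sub>C v) = c *\<^sub>C D v))"

definition holomorphic_map :: "('i ell2 \<Rightarrow> 'j ell2) \<Rightarrow> 'i ell2 set \<Rightarrow> bool" where
  "holomorphic_map F W \<longleftrightarrow>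
     (\<forall>x\<in>W. \<exists>r>0. \<exists>G. holomorphic_open G (ball x r) \<and> (\<forall>y\<in>W \<inter> ball x r. F y = G y))"

definition biholomorphism :: "('i ell2 \<Rightarrow> 'j ell2) \<Rightarrow> 'i ell2 set \<Rightarrow> 'j ell2 set \<Rightarrow> bool" where
  "biholomorphism F W V \<longleftrightarrow>
     bij_betw F W V \<and> holomorphic_map F W \<and> holomorphic_map (inv_into W F) V"

text \<open>
  For \<open>w = 0\<close> the projection is zero, by the convention that division by zero yields zero.
\<close>

definition proj :: "'i ell2 \<Rightarrow> 'i ell2 \<Rightarrow> 'i ell2" where
  "proj w z = (cinner z w / cinner w w) *\<^sub>C w"

definition ball_automorphism :: "'i ell2 \<Rightarrow> 'i ell2 \<Rightarrow> 'i ell2" where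
  "ball_automorphism w z =
     (1 / (1 - cinner z w)) *\<^sub>C (w - proj w z - sqrt (1 - (norm w)\<^sup>2) *\<^sub>R (z - proj w z))"

definition pseudohyperbolic :: "'i ell2 \<Rightarrow> 'i ell2 \<Rightarrow> real" where
  "pseudohyperbolic z w = norm (ball_automorphism w z)"

text \<open>
  Functions on a set \<open>X\<close> are represented by total functions that vanish outside \<open>X\<close>, so that equality
  of functions on \<open>X\<close> is equality of the representatives.
\<close>

definition funs_on :: "'a set \<Rightarrow> ('a \<Rightarrow> complex) set" where
  "funs_on X = {f. \<forall>x. x \<notin> X \<longrightarrow> f x = 0}"

definition restrict_to :: "'a set \<Rightarrow> ('a \<Rightarrow> complex) \<Rightarrow> 'a \<Rightarrow> complex" where
  "restrict_to X f = (\<lambda>x. if x \<in> X then f x else 0)"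

text \<open>
  \<open>rkhs X K H ip\<close>: the set \<open>H\<close> of functions on \<open>X\<close> is, with inner product \<open>ip\<close>, a complex Hilbert
  space with reproducing kernel \<open>K\<close>.  By the Moore-Aronszajn theorem \<open>H\<close> and the restriction of
  \<open>ip\<close> to \<open>H\<close> exist and are unique for every positive semidefinite \<open>K\<close>.
\<close>

definition ip_norm :: "(('a \<Rightarrow> complex) \<Rightarrow> ('a \<Rightarrow> complex) \<Rightarrow> complex) \<Rightarrow> ('a \<Rightarrow> complex) \<Rightarrow> real" where
  "ip_norm ip f = sqrt (Re (ip f f))"

locale rkhs =
  fixes X :: "'a set"
    and K :: "'a \<Rightarrow> 'a \<Rightarrow> complex"
    and H :: "('a \<Rightarrow> complex) set"
    and ip :: "('a \<Rightarrow> complex) \<Rightarrow> ('a \<Rightarrow> complex) \<Rightarrow> complex"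
  assumes subset_funs: "H \<subseteq> funs_on X"
    and zero_mem: "(\<lambda>_. 0) \<in> H"
    and add_mem: "f \<in> H \<Longrightarrow> g \<in> H \<Longrightarrow> (\<lambda>x. f x + g x) \<in> H"
    and scale_mem: "f \<in> H \<Longrightarrow> (\<lambda>x. c * f x) \<in> H"
    and ip_add: "f \<in> H \<Longrightarrow> g \<in> H \<Longrightarrow> h \<in> H \<Longrightarrow> ip (\<lambda>x. f x + g x) h = ip f h + ip g h"
    and ip_scale: "f \<in> H \<Longrightarrow> g \<in> H \<Longrightarrow> ip (\<lambda>x. c * f x) g = c * ip f g"
    and ip_sym: "f \<in> H \<Longrightarrow> g \<in> H \<Longrightarrow> ip g f = cnj (ip f g)"
    and ip_nonneg: "f \<in> H \<Longrightarrow> 0 \<le> Re (ip f f)"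
    and ip_definite: "f \<in> H \<Longrightarrow> ip f f = 0 \<Longrightarrow> f = (\<lambda>_. 0)"
    and complete:
      "(\<And>n :: nat. u n \<in> H) \<Longrightarrow>
       (\<And>e. 0 < e \<Longrightarrow> \<exists>N. \<forall>m\<ge>N. \<forall>n\<ge>N. ip_norm ip (\<lambda>x. u m x - u n x) < e) \<Longrightarrow>
       \<exists>f\<in>H. (\<lambda>n. ip_norm ip (\<lambda>x. u n x - f x)) \<longlonglongrightarrow> 0"
    and kernel_mem: "y \<in> X \<Longrightarrow> restrict_to X (\<lambda>x. K x y) \<in> H"
    and reproducing: "f \<in> H \<Longrightarrow> y \<in> X \<Longrightarrow> ip f (restrict_to X (\<lambda>x. K x y)) = f y"

definition multipliers :: "'a set \<Rightarrow> ('a \<Rightarrow> complex) set \<Rightarrow> ('a \<Rightarrow> complex) set" where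
  "multipliers X H = {h \<in> funs_on X. \<forall>f\<in>H. (\<lambda>x. h x * f x) \<in> H}"

definition da_kernel :: "'i ell2 \<Rightarrow> 'i ell2 \<Rightarrow> complex" where
  "da_kernel x y = 1 / (1 - cinner x y)"

definition drury_arveson ::
  "('i ell2 \<Rightarrow> complex) set \<Rightarrow> (('i ell2 \<Rightarrow> complex) \<Rightarrow> ('i ell2 \<Rightarrow> complex) \<Rightarrow> complex) \<Rightarrow> bool" where
  "drury_arveson H ip \<longleftrightarrow> rkhs (ball 0 1) da_kernel H ip"

definition variety :: "('i ell2 \<Rightarrow> complex) set \<Rightarrow> 'i ell2 set \<Rightarrow> bool" where
  "variety H V \<longleftrightarrow>
     (\<exists>S \<subseteq> multipliers (ball 0 1) H. V = {x \<in> ball 0 1. \<forall>h\<in>S. h x = 0})"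

definition kernel_span :: "'i ell2 set \<Rightarrow> ('i ell2 \<Rightarrow> complex) set" where
  "kernel_span V =
     {f. \<exists>T c. finite T \<and> T \<subseteq> V \<and>
           f = (\<lambda>x. \<Sum>y\<in>T. c y * restrict_to (ball 0 1) (\<lambda>x. da_kernel x y) x)}"

definition ip_closure ::
  "('a \<Rightarrow> complex) set \<Rightarrow> (('a \<Rightarrow> complex) \<Rightarrow> ('a \<Rightarrow> complex) \<Rightarrow> complex) \<Rightarrow>
     ('a \<Rightarrow> complex) set \<Rightarrow> ('a \<Rightarrow> complex) set" where
  "ip_closure H ip S = {f \<in> H. \<forall>e>0. \<exists>g\<in>S. ip_norm ip (\<lambda>x. f x - g x) < e}"

definition H_var ::
  "('i ell2 \<Rightarrow> complex) set \<Rightarrow> (('i ell2 \<Rightarrow> complex) \<Rightarrow> ('i ell2 \<Rightarrow> complex) \<Rightarrow> complex) \<Rightarrow>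
     'i ell2 set \<Rightarrow> ('i ell2 \<Rightarrow> complex) set" where
  "H_var H ip V = restrict_to V ` ip_closure H ip (kernel_span V)"

definition M_var ::
  "('i ell2 \<Rightarrow> complex) set \<Rightarrow> (('i ell2 \<Rightarrow> complex) \<Rightarrow> ('i ell2 \<Rightarrow> complex) \<Rightarrow> complex) \<Rightarrow>
     'i ell2 set \<Rightarrow> ('i ell2 \<Rightarrow> complex) set" where
  "M_var H ip V = multipliers V (H_var H ip V)"

definition algebra_iso ::
  "('a \<Rightarrow> complex) set \<Rightarrow> ('b \<Rightarrow> complex) set \<Rightarrow>
     (('a \<Rightarrow> complex) \<Rightarrow> ('b \<Rightarrow> complex)) \<Rightarrow> bool" where
  "algebra_iso A B \<phi> \<longleftrightarrow>
     bij_betw \<phi> A B \<and>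
     (\<forall>f\<in>A. \<forall>g\<in>A. \<phi> (\<lambda>x. f x + g x) = (\<lambda>x. \<phi> f x + \<phi> g x)) \<and>
     (\<forall>f\<in>A. \<forall>g\<in>A. \<phi> (\<lambda>x. f x * g x) = (\<lambda>x. \<phi> f x * \<phi> g x)) \<and>
     (\<forall>f\<in>A. \<forall>c. \<phi> (\<lambda>x. c * f x) = (\<lambda>x. c * \<phi> f x))"

end

theory Submission
  imports Defs
begin

text \<open>
  A multiplier \<open>g\<close> on a set \<open>W\<close> in the ball is Lipschitz for the pseudohyperbolic distance
  \<open>\<delta>\<close>: the adjoint of multiplication by \<open>g\<close> sends the kernel function \<open>k\<^sub>x\<close> to
  \<open>cnj (g x) k\<^sub>x\<close>, and \<open>1 - \<delta>(x,y)\<^sup>2 = \<bar>\<langle>k\<^sub>x,k\<^sub>y\<rangle>\<bar>\<^sup>2 / (\<parallel>k\<^sub>x\<parallel>\<^sup>2 \<parallel>k\<^sub>y\<parallel>\<^sup>2)\<close>, so that a bounded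
  adjoint cannot have very different eigenvalues at two nearly parallel kernel functions
  (\<open>adjoint_bounded_lipschitz\<close>).  Conversely the components of the automorphisms of the ball are
  contractive multipliers, and some such component \<open>h\<close> realizes the distance of two prescribed
  points, \<open>\<bar>h(a) - h(b)\<bar> = \<delta>(a,b)\<close> (\<open>separating_contraction\<close>).

  Suppose that composition with \<open>F : W \<rightarrow> V\<close> maps multipliers on \<open>V\<close> to multipliers on \<open>W\<close>.  If
  composition were bounded by \<open>M\<close>, then \<open>\<delta>(F \<xi>, F \<mu>) = \<bar>h(F \<xi>) - h(F \<mu>)\<bar> \<le> 4 M \<delta>(\<xi>,\<mu>)\<close> for a
  contraction \<open>h\<close> that separates \<open>F \<xi>\<close> and \<open>F \<mu>\<close>.  Boundedness would follow from the closed graph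
  theorem; instead, a gliding hump (\<open>gliding_hump\<close>) gives the estimate directly.  If the
  ratios \<open>\<delta>(F \<xi>, F \<mu>) / \<delta>(\<xi>,\<mu>)\<close> were unbounded, one could choose pairs whose separating contractions
  \<open>h\<^sub>n\<close> make \<open>s = \<Sum>\<^sub>n 8\<^sup>-\<^sup>n h\<^sub>n\<close> a multiplier for which \<open>s \<circ> F\<close> is not Lipschitz
  (\<open>composition_pseudohyperbolic_lipschitz\<close>).  The lower estimate of the theorem is this upper estimate
  for the inverse of \<open>F\<close>.

  That a multiplier on \<open>W\<close> has a bounded adjoint is the uniform boundedness principle, which comes
  from the same gliding hump.  The multipliers on \<open>V\<close> are the functions on \<open>V\<close> with bounded adjoint
  (\<open>multipliers_restriction_iff\<close>), because every function on \<open>V\<close> that satisfies the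
  evident norm condition on kernel combinations is interpolated by an element of \<open>H\<close>; this is a form of
  the Riesz representation theorem (\<open>riesz_relation\<close>, \<open>interpolation\<close>).
\<close>

section \<open>The gliding hump\<close>

lemma geometric_tail: "(\<Sum>m. (1/8)^(m + Suc n)) = (1/8::real)^n / 7"
proof -
  have "(\<lambda>m. (1/8::real)^m * (1/8)^Suc n) sums ((1 / (1 - 1/8)) * (1/8)^Suc n)"
    by (intro sums_mult2 geometric_sums) simp
  then show ?thesis
    by (simp add: power_add sums_iff)
qed

text \<open>
  A scalar form of the uniform boundedness principle.  Entry \<open>A i j\<close> stands for the \<open>i\<close>-th functional
  at the \<open>j\<close>-th unit vector, and \<open>c i\<close> for a bound on the norm of the \<open>i\<close>-th functional, attained up to the factor \<open>4\<close>
  at the \<open>i\<close>-th vector.  If \<open>c\<close> were unbounded, one chooses \<open>J n\<close> with \<open>c (J n)\<close> far beyond \<open>8\<^sup>n\<close> times the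
  column bounds of the earlier choices.  In \<open>\<Sum>\<^sub>m 8\<^sup>-\<^sup>m A (J n) (J m)\<close> the diagonal term is then at least
  \<open>8\<^sup>-\<^sup>n c (J n) / 4\<close>, while the later terms add up to at most \<open>8\<^sup>-\<^sup>n c (J n) / 7\<close> and the earlier ones are negligible.
\<close>

lemma gliding_hump:
  fixes A :: "'i \<Rightarrow> 'i \<Rightarrow> complex" and c :: "'i \<Rightarrow> real"
  assumes row: "\<And>i j. i \<in> I \<Longrightarrow> j \<in> I \<Longrightarrow> cmod (A i j) \<le> c i"
    and diagonal: "\<And>i. i \<in> I \<Longrightarrow> c i \<le> 4 * cmod (A i i)"
    and column: "\<And>j. j \<in> I \<Longrightarrow> \<exists>B. \<forall>i\<in>I. cmod (A i j) \<le> B"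
    and series: "\<And>J :: nat \<Rightarrow> 'i. (\<And>n. J n \<in> I) \<Longrightarrow>
                   \<exists>B. \<forall>i\<in>I. cmod (\<Sum>n. (1/8)^n * A i (J n)) \<le> B"
  shows "\<exists>C. \<forall>i\<in>I. c i \<le> C"
proof (rule ccontr)
  assume "\<not> ?thesis"
  then have large: "\<exists>i\<in>I. C < c i" for C
    by (meson not_le)
  obtain L where L: "\<And>i j. i \<in> I \<Longrightarrow> j \<in> I \<Longrightarrow> cmod (A i j) \<le> L j"
    using column by metis
  have L0: "0 \<le> L j" if "j \<in> I" for j
    using L[OF that that] norm_ge_zero order_trans by blast
  \<comment> \<open>The second component of \<open>f n\<close> accumulates the column bounds of the indices chosen so far; the first
     component of \<open>f 0\<close> is an arbitrary index, so the choices proper start at \<open>f (Suc n)\<close>.\<close>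
  have "\<exists>f. \<forall>n. (fst (f n) \<in> I \<and> 0 \<le> snd (f n)) \<and>
      (snd (f (Suc n)) = snd (f n) + L (fst (f (Suc n))) \<and>
       8 ^ n * 10 * (real n + snd (f n)) < c (fst (f (Suc n))))"
  proof (rule dependent_nat_choice)
    obtain i where "i \<in> I" using large by blast
    then show "\<exists>x. fst x \<in> I \<and> 0 \<le> (snd x :: real)"
      by (intro exI[of _ "(i, 0)"]) simp
    fix x :: "'i \<times> real" and n :: nat
    assume x: "fst x \<in> I \<and> 0 \<le> snd x"
    obtain i where "i \<in> I" "8 ^ n * 10 * (real n + snd x) < c i" using large by blast
    then show "\<exists>y. (fst y \<in> I \<and> 0 \<le> snd y) \<and> snd y = snd x + L (fst y)
        \<and> 8 ^ n * 10 * (real n + snd x) < c (fst y)"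
      using x L0 by (intro exI[of _ "(i, snd x + L i)"]) simp
  qed
  then obtain f where fI: "\<And>n. fst (f n) \<in> I" and f0: "\<And>n. 0 \<le> snd (f n)"
    and fS: "\<And>n. snd (f (Suc n)) = snd (f n) + L (fst (f (Suc n)))"
    and fc: "\<And>n. 8 ^ n * 10 * (real n + snd (f n)) < c (fst (f (Suc n)))"
    by blast
  define J where "J = (\<lambda>n. fst (f (Suc n)))"
  define S where "S = (\<lambda>n. snd (f n))"
  have JI: "J n \<in> I" for n by (simp add: J_def fI)
  have cJ: "8 ^ n * 10 * (real n + S n) < c (J n)" for n
    using fc by (simp add: J_def S_def)
  have sumL: "(\<Sum>k<n. L (J k)) \<le> S n" for n
    by (induction n) (use f0 fS in \<open>simp_all add: S_def J_def\<close>)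
  obtain B where B: "\<And>i. i \<in> I \<Longrightarrow> cmod (\<Sum>n. (1/8)^n * A i (J n)) \<le> B"
    using series[of J] JI by blast
  have "real n \<le> B" for n
  proof -
    define a where "a = (\<lambda>m. (1/8)^m * A (J n) (J m))"
    have a_le: "cmod (a m) \<le> c (J n) * (1/8)^m" for m
      using mult_right_mono[OF row[OF JI[of n] JI[of m]], of "(1/8)^m"]
      by (simp add: a_def norm_mult norm_power norm_divide mult.commute)
    have summ: "summable (\<lambda>m. c (J n) * (1/8)^m)"
      by (intro summable_mult summable_geometric) simp
    have na: "summable (\<lambda>m. cmod (a m))"
      by (rule summable_comparison_test'[OF summ]) (use a_le in simp)
    have sa: "summable a" by (rule summable_norm_cancel[OF na])
    have "cmod (\<Sum>m. a (m + Suc n)) \<le> (\<Sum>m. cmod (a (m + Suc n)))"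
      by (intro summable_norm) (subst summable_iff_shift, rule na)
    also have "\<dots> \<le> (\<Sum>m. c (J n) * (1/8)^(m + Suc n))"
      by (intro suminf_le a_le) (subst summable_iff_shift, rule na summ)+
    also have "\<dots> = c (J n) * ((1/8)^n / 7)"
      by (subst suminf_mult) (use geometric_tail[of n] in \<open>auto simp: summable_iff_shift summable_geometric\<close>)
    finally have tail: "cmod (\<Sum>m. a (m + Suc n)) \<le> c (J n) * ((1/8)^n / 7)" .
    have "cmod (\<Sum>k<n. a k) \<le> (\<Sum>k<n. L (J k))"
    proof (rule sum_norm_le)
      fix k
      have "cmod (a k) \<le> (1/8)^k * L (J k)"
        using mult_left_mono[OF L[OF JI[of n] JI[of k]], of "(1/8)^k"]
        by (simp add: a_def norm_mult norm_power norm_divide)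
      also have "\<dots> \<le> 1 * L (J k)"
        by (intro mult_right_mono L0 JI power_le_one) auto
      finally show "cmod (a k) \<le> L (J k)" by simp
    qed
    with sumL[of n] have head: "cmod (\<Sum>k<n. a k) \<le> S n" by linarith
    have diag: "c (J n) * (1/8)^n \<le> 4 * cmod (a n)"
      using mult_right_mono[OF diagonal[OF JI[of n]], of "(1/8)^n"]
      by (simp add: a_def norm_mult norm_power norm_divide mult_ac)
    have "suminf a = (\<Sum>m. a (m + Suc n)) + (\<Sum>k<n. a k) + a n"
      using suminf_split_initial_segment[OF sa, of "Suc n"] by simp
    then have "cmod (a n) \<le> cmod (suminf a) + cmod (\<Sum>m. a (m + Suc n)) + cmod (\<Sum>k<n. a k)"
      using norm_triangle_ineq4[of "suminf a - (\<Sum>m. a (m + Suc n))" "\<Sum>k<n. a k"]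
        norm_triangle_ineq4[of "suminf a" "\<Sum>m. a (m + Suc n)"]
      by (simp add: algebra_simps)
    moreover have "cmod (suminf a) \<le> B"
      using B[OF JI[of n]] by (simp add: a_def)
    moreover have "10 * (real n + S n) \<le> c (J n) * (1/8)^n"
      using cJ[of n] by (simp add: field_simps power_divide)
    moreover have "0 \<le> S n" using f0 by (simp add: S_def)
    ultimately show ?thesis using tail head diag by simp
  qed
  then show False
    by (meson reals_Archimedean2 not_le)
qed

section \<open>The inner product of the sequence space and the automorphisms of its ball\<close>

lemma cinner_has_sum: "((\<lambda>i. coord x i * cnj (coord y i)) has_sum cinner x y) UNIV"
  unfolding cinner_def by (intro has_sum_infsum product_summable coord_summable)

lemma cinner_eqI: "((\<lambda>i. coord x i * cnj (coord y i)) has_sum s) UNIV \<Longrightarrow> cinner x y = s"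
  using cinner_has_sum has_sum_unique by blast

lemma cinner_commute: "cinner y x = cnj (cinner x y)"
  unfolding cinner_def infsum_cnj[symmetric] by (simp add: mult.commute)

lemma cinner_add_left: "cinner (x + y) z = cinner x z + cinner y z"
  by (rule cinner_eqI)
     (use has_sum_add[OF cinner_has_sum[of x z] cinner_has_sum[of y z]] in
       \<open>simp add: plus_ell2.rep_eq distrib_right\<close>)

lemma cinner_scaleC_left: "cinner (c *\<^sub>C x) z = c * cinner x z"
  by (rule cinner_eqI)
     (use has_sum_cmult_right[OF cinner_has_sum[of x z], of c] in
       \<open>simp add: scaleC.rep_eq mult.assoc\<close>)

lemma cinner_diff_left: "cinner (x - y) z = cinner x z - cinner y z"
  using cinner_add_left[of "x - y" y z] by simp

lemma cinner_scaleC_right: "cinner x (c *\<^sub>C y) = cnj c * cinner x y"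
  by (subst (1 2) cinner_commute) (simp add: cinner_scaleC_left)

lemma cinner_diff_right: "cinner x (y - z) = cinner x y - cinner x z"
  by (subst (1 2 3) cinner_commute) (simp add: cinner_diff_left)

lemma cinner_self: "cinner x x = complex_of_real ((norm x)\<^sup>2)"
proof (rule complex_eqI)
  show "Re (cinner x x) = Re (complex_of_real ((norm x)\<^sup>2))"
    using power2_norm_eq_inner[of x] by (simp add: inner_ell2_def)
  show "Im (cinner x x) = Im (complex_of_real ((norm x)\<^sup>2))"
    using arg_cong[OF cinner_commute[of x x], of Im] by simp
qed

lemma scaleR_eq_scaleC: "r *\<^sub>R x = complex_of_real r *\<^sub>C x"
  by (rule ell2_eqI) (simp add: scaleR_ell2.rep_eq scaleC.rep_eq)

lemma norm_scaleC: "norm (c *\<^sub>C x) = cmod c * norm x"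
proof -
  have "complex_of_real ((norm (c *\<^sub>C x))\<^sup>2) = complex_of_real ((cmod c * norm x)\<^sup>2)"
    unfolding cinner_self[symmetric] cinner_scaleC_left cinner_scaleC_right
    by (simp add: cinner_self power_mult_distrib complex_norm_square[unfolded of_real_power] mult.commute[of "cnj c"])
  then have "(norm (c *\<^sub>C x))\<^sup>2 = (cmod c * norm x)\<^sup>2" by (simp only: of_real_eq_iff)
  then show ?thesis by (rule power2_eq_imp_eq) auto
qed

lemma cinner_le_norm: "cmod (cinner x y) \<le> norm x * norm y"
proof (cases "cinner x y = 0")
  case False
  define u where "u = cnj (cinner x y) / cmod (cinner x y)"
  have u: "cmod u = 1" using False by (simp add: u_def norm_divide)
  have "u * cinner x y = complex_of_real (cmod (cinner x y))"
    using False complex_norm_square[of "cinner x y"]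
    by (simp add: u_def field_simps power2_eq_square)
  then have "cmod (cinner x y) = Re (u * cinner x y)" by simp
  also have "\<dots> = inner (u *\<^sub>C x) y"
    by (simp add: inner_ell2_def cinner_scaleC_left)
  also have "\<dots> \<le> norm (u *\<^sub>C x) * norm y" by (rule norm_cauchy_schwarz)
  finally show ?thesis by (simp add: norm_scaleC u)
qed simp

lemma cinner_ball_neq_1:
  assumes "x \<in> ball 0 1" "y \<in> ball 0 1"
  shows "1 - cinner x y \<noteq> 0"
proof
  assume "1 - cinner x y = 0"
  then have "1 \<le> norm x * norm y" using cinner_le_norm[of x y] by simp
  moreover have "norm x * norm y < 1 * 1" using assms by (intro mult_strict_mono) auto
  ultimately show False by simp
qed

text \<open>
  With \<open>\<alpha> x *\<^sub>C a\<close> the projection of \<open>x\<close> to the line through \<open>a\<close>, the automorphism is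
  \<open>N x = (1 - \<alpha> x) *\<^sub>C a - s *\<^sub>C (x - \<alpha> x *\<^sub>C a)\<close> divided by \<open>1 - cinner x a\<close>.  The two summands of \<open>N x\<close> are
  orthogonal, so \<open>cinner (N z) (N w)\<close> is computed from their separate inner products.
\<close>

lemma cinner_ball_automorphism:
  assumes z: "z \<in> ball 0 1" and w: "w \<in> ball 0 1" and a: "a \<in> ball 0 1"
  shows "1 - cinner (ball_automorphism a z) (ball_automorphism a w) =
    (1 - (norm a)\<^sup>2) * (1 - cinner z w) / ((1 - cinner z a) * (1 - cinner a w))"
proof -
  define r where "r = complex_of_real ((norm a)\<^sup>2)"
  define s where "s = complex_of_real (sqrt (1 - (norm a)\<^sup>2))"
  define \<alpha> where "\<alpha> = (\<lambda>x. cinner x a / r)"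
  define N where "N = (\<lambda>x. a - \<alpha> x *\<^sub>C a - s *\<^sub>C (x - \<alpha> x *\<^sub>C a))"
  have raa: "cinner a a = r" by (simp add: r_def cinner_self)
  have rr: "cnj r = r" "cnj s = s" by (simp_all add: r_def s_def)
  have "(norm a)\<^sup>2 \<le> 1" using a by (simp add: power_le_one)
  then have ss: "s * s = 1 - r"
    unfolding s_def r_def of_real_mult[symmetric] by simp
  have aut: "ball_automorphism a x = (1 / (1 - cinner x a)) *\<^sub>C N x" for x
    by (simp add: ball_automorphism_def proj_def N_def \<alpha>_def raa s_def scaleR_eq_scaleC)
  have key: "cinner (N z) (N w) = (1 - cinner z a) * (1 - cinner a w) - (1 - r) * (1 - cinner z w)"
  proof (cases "a = 0")
    case True
    then have rs: "r = 0" "s = 1" by (simp_all add: r_def s_def)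
    have N0: "N x = (-1) *\<^sub>C x" for x
      unfolding N_def using True rs
      by (intro ell2_eqI) (simp add: minus_ell2.rep_eq uminus_ell2.rep_eq scaleC.rep_eq zero_ell2.rep_eq)
    have "cinner x 0 = 0" "cinner 0 x = 0" for x :: "'a ell2"
      using cinner_diff_left[of 0 0 x] cinner_diff_right[of x 0 0] by simp_all
    then show ?thesis
      using True rs by (simp add: N0 cinner_scaleC_left cinner_scaleC_right)
  next
    case False
    then have r0: "r \<noteq> 0" by (simp add: r_def)
    have perp: "cinner (x - \<alpha> x *\<^sub>C a) a = 0" for x
      using r0 by (simp add: cinner_diff_left cinner_scaleC_left raa \<alpha>_def)
    have perp': "cinner a (x - \<alpha> x *\<^sub>C a) = 0" for x
      using perp[of x] cinner_commute[of a "x - \<alpha> x *\<^sub>C a"] by simp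
    have Nx: "N x = (1 - \<alpha> x) *\<^sub>C a - s *\<^sub>C (x - \<alpha> x *\<^sub>C a)" for x
      unfolding N_def by (rule ell2_eqI) (simp add: plus_ell2.rep_eq minus_ell2.rep_eq scaleC.rep_eq algebra_simps)
    have "cinner (N z) (N w) = (1 - \<alpha> z) * cnj (1 - \<alpha> w) * r
        + s * s * cinner (z - \<alpha> z *\<^sub>C a) (w - \<alpha> w *\<^sub>C a)"
      unfolding Nx cinner_diff_left[of "_ *\<^sub>C a" "s *\<^sub>C _"] cinner_diff_right[of _ "_ *\<^sub>C a" "s *\<^sub>C _"]
        cinner_scaleC_left cinner_scaleC_right perp perp' raa
      by (simp add: rr)
    also have "cinner (z - \<alpha> z *\<^sub>C a) (w - \<alpha> w *\<^sub>C a) = cinner z w - \<alpha> z * cinner a w"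
      using perp'[of w] by (subst cinner_diff_left)
        (simp add: cinner_scaleC_left, simp add: cinner_diff_right cinner_scaleC_right cinner_commute[of w a] \<alpha>_def rr r0)
    also have "cnj (1 - \<alpha> w) = 1 - cinner a w / r"
      by (simp add: \<alpha>_def rr cinner_commute[of w a])
    also have "(1 - \<alpha> z) * (1 - cinner a w / r) * r + s * s * (cinner z w - \<alpha> z * cinner a w)
        = (1 - cinner z a) * (1 - cinner a w) - (1 - r) * (1 - cinner z w)"
      unfolding ss \<alpha>_def using r0 by (simp add: field_simps)
    finally show ?thesis .
  qed
  have nz: "1 - cinner z a \<noteq> 0" "1 - cinner a w \<noteq> 0"
    using cinner_ball_neq_1 assms by blast+
  have "cinner (ball_automorphism a z) (ball_automorphism a w)
      = cinner (N z) (N w) / ((1 - cinner z a) * (1 - cinner a w))"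
    by (simp add: aut cinner_scaleC_left cinner_scaleC_right cinner_commute[of w a])
  also have "\<dots> = 1 - (1 - r) * (1 - cinner z w) / ((1 - cinner z a) * (1 - cinner a w))"
    using nz by (simp add: key diff_divide_distrib)
  finally show ?thesis by (simp add: r_def)
qed

lemma da_kernel_diag: "da_kernel x x = complex_of_real (1 / (1 - (norm x)\<^sup>2))"
  by (simp add: da_kernel_def cinner_self)

text \<open>
  The pseudohyperbolic distance is the sine of the angle between kernel functions.
\<close>

lemma pseudohyperbolic_sq:
  assumes "z \<in> ball 0 1" "w \<in> ball 0 1"
  shows "(pseudohyperbolic z w)\<^sup>2 =
    1 - (cmod (da_kernel z w))\<^sup>2 / (Re (da_kernel z z) * Re (da_kernel w w))"
proof -
  have "complex_of_real (1 - (pseudohyperbolic z w)\<^sup>2)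
      = (1 - (norm w)\<^sup>2) * (1 - (norm z)\<^sup>2) / ((1 - cinner z w) * (1 - cinner w z))"
    using cinner_ball_automorphism[OF assms(1,1,2)]
    by (simp add: pseudohyperbolic_def cinner_self)
  also have "(1 - cinner z w) * (1 - cinner w z) = complex_of_real ((cmod (1 - cinner z w))\<^sup>2)"
    by (simp add: complex_norm_square cinner_commute[of z w] del: of_real_power)
  finally have "complex_of_real (1 - (pseudohyperbolic z w)\<^sup>2)
      = complex_of_real ((1 - (norm w)\<^sup>2) * (1 - (norm z)\<^sup>2) / (cmod (1 - cinner z w))\<^sup>2)"
    by simp
  then have "1 - (pseudohyperbolic z w)\<^sup>2
      = (1 - (norm w)\<^sup>2) * (1 - (norm z)\<^sup>2) / (cmod (1 - cinner z w))\<^sup>2"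
    by (simp only: of_real_eq_iff)
  then show ?thesis
    unfolding da_kernel_diag by (simp add: da_kernel_def norm_divide power_divide field_simps)
qed

lemma da_kernel_diag_pos: "x \<in> ball 0 1 \<Longrightarrow> 0 < Re (da_kernel x x)"
  by (simp add: da_kernel_diag power_less_one_iff)

lemma has_sum_finite_sum:
  fixes f :: "'b \<Rightarrow> 'c \<Rightarrow> complex"
  assumes "\<And>t. t \<in> T \<Longrightarrow> (f t has_sum s t) A"
  shows "((\<lambda>l. \<Sum>t\<in>T. f t l) has_sum (\<Sum>t\<in>T. s t)) A"
  using assms by (induction T rule: infinite_finite_induct) (auto intro: has_sum_add)

text \<open>
  The Schur product of a Gram matrix with a positive semidefinite matrix is positive semidefinite: the
  quadratic form is a sum, over the coordinates \<open>l\<close>, of values of the form of \<open>K\<close> at the vectors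
  \<open>c x * cnj (coord (\<psi> x) l)\<close>.
\<close>

lemma schur_product_gram:
  fixes K :: "'a \<Rightarrow> 'a \<Rightarrow> complex" and \<psi> :: "'a \<Rightarrow> 'i ell2"
  assumes psd: "\<And>c. 0 \<le> Re (\<Sum>x\<in>T. \<Sum>y\<in>T. cnj (c x) * c y * K x y)"
  shows "0 \<le> Re (\<Sum>x\<in>T. \<Sum>y\<in>T. cnj (c x) * c y * (cinner (\<psi> x) (\<psi> y) * K x y))"
proof -
  have "((\<lambda>l. \<Sum>x\<in>T. \<Sum>y\<in>T. cnj (c x) * c y * (coord (\<psi> x) l * cnj (coord (\<psi> y) l) * K x y)) has_sum
      (\<Sum>x\<in>T. \<Sum>y\<in>T. cnj (c x) * c y * (cinner (\<psi> x) (\<psi> y) * K x y))) UNIV"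
    by (intro has_sum_finite_sum has_sum_cmult_right has_sum_cmult_left cinner_has_sum)
  then have "((\<lambda>l. Re (\<Sum>x\<in>T. \<Sum>y\<in>T. cnj (c x) * c y * (coord (\<psi> x) l * cnj (coord (\<psi> y) l) * K x y))) has_sum
      Re (\<Sum>x\<in>T. \<Sum>y\<in>T. cnj (c x) * c y * (cinner (\<psi> x) (\<psi> y) * K x y))) UNIV"
    by (rule has_sum_Re)
  then show ?thesis
  proof (rule has_sum_nonneg)
    fix l
    show "0 \<le> Re (\<Sum>x\<in>T. \<Sum>y\<in>T. cnj (c x) * c y * (coord (\<psi> x) l * cnj (coord (\<psi> y) l) * K x y))"
      using psd[of "\<lambda>x. c x * cnj (coord (\<psi> x) l)"] by (simp add: mult_ac)
  qed
qed

section \<open>Hilbert space geometry in a reproducing kernel Hilbert space\<close>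

lemma sum_union_zero_extended:
  fixes f :: "'b \<Rightarrow> complex"
  assumes "finite S" "finite T"
  shows "(\<Sum>y\<in>S \<union> T. ((if y \<in> S then c y else 0) + (if y \<in> T then d y else 0)) * f y)
    = (\<Sum>y\<in>S. c y * f y) + (\<Sum>y\<in>T. d y * f y)"
proof -
  have "(\<Sum>y\<in>S \<union> T. (if y \<in> S then c y else 0) * f y) = (\<Sum>y\<in>S. c y * f y)"
    using assms by (intro sum.mono_neutral_cong_right) auto
  moreover have "(\<Sum>y\<in>S \<union> T. (if y \<in> T then d y else 0) * f y) = (\<Sum>y\<in>T. d y * f y)"
    using assms by (intro sum.mono_neutral_cong_right) auto
  ultimately show ?thesis by (simp add: distrib_right sum.distrib)
qed

context rkhs
begin

abbreviation nrm :: "('a \<Rightarrow> complex) \<Rightarrow> real" where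
  "nrm \<equiv> ip_norm ip"

lemma diff_mem: "f \<in> H \<Longrightarrow> g \<in> H \<Longrightarrow> (\<lambda>x. f x - g x) \<in> H"
  using add_mem[OF _ scale_mem[of g "-1"]] by simp

lemma sum_mem: "finite T \<Longrightarrow> (\<And>y. y \<in> T \<Longrightarrow> f y \<in> H) \<Longrightarrow> (\<lambda>x. \<Sum>y\<in>T. f y x) \<in> H"
  by (induction T rule: finite_induct) (auto simp: zero_mem intro: add_mem)

lemma ip_zero: "g \<in> H \<Longrightarrow> ip (\<lambda>_. 0) g = 0"
  using ip_scale[OF zero_mem, of g 0] by simp

lemma ip_diff: "f \<in> H \<Longrightarrow> g \<in> H \<Longrightarrow> h \<in> H \<Longrightarrow> ip (\<lambda>x. f x - g x) h = ip f h - ip g h"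
  using ip_add[OF _ scale_mem[of g "-1"]] ip_scale[of g h "-1"] by simp

lemma ip_sum:
  "finite T \<Longrightarrow> (\<And>y. y \<in> T \<Longrightarrow> f y \<in> H) \<Longrightarrow> g \<in> H \<Longrightarrow>
     ip (\<lambda>x. \<Sum>y\<in>T. f y x) g = (\<Sum>y\<in>T. ip (f y) g)"
  by (induction T rule: finite_induct) (auto simp: ip_zero ip_add sum_mem)

lemma ip_add_right: "f \<in> H \<Longrightarrow> g \<in> H \<Longrightarrow> h \<in> H \<Longrightarrow> ip h (\<lambda>x. f x + g x) = ip h f + ip h g"
  by (simp add: ip_sym[of _ h] add_mem ip_add)

lemma ip_diff_right: "f \<in> H \<Longrightarrow> g \<in> H \<Longrightarrow> h \<in> H \<Longrightarrow> ip h (\<lambda>x. f x - g x) = ip h f - ip h g"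
  by (simp add: ip_sym[of _ h] diff_mem ip_diff)

lemma ip_scale_right: "f \<in> H \<Longrightarrow> g \<in> H \<Longrightarrow> ip f (\<lambda>x. c * g x) = cnj c * ip f g"
  by (simp add: ip_sym[of _ f] scale_mem ip_scale)

lemma ip_sum_right:
  "finite T \<Longrightarrow> (\<And>y. y \<in> T \<Longrightarrow> f y \<in> H) \<Longrightarrow> g \<in> H \<Longrightarrow>
     ip g (\<lambda>x. \<Sum>y\<in>T. f y x) = (\<Sum>y\<in>T. ip g (f y))"
  by (simp add: ip_sym[of _ g] sum_mem ip_sum)

lemma nrm_ge_0: "f \<in> H \<Longrightarrow> 0 \<le> nrm f"
  by (simp add: ip_norm_def ip_nonneg)

lemma nrm_sq: "f \<in> H \<Longrightarrow> (nrm f)\<^sup>2 = Re (ip f f)"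
  by (simp add: ip_norm_def ip_nonneg)

lemma ip_self: "f \<in> H \<Longrightarrow> ip f f = complex_of_real ((nrm f)\<^sup>2)"
  using arg_cong[OF ip_sym[of f f], of Im] by (simp add: nrm_sq complex_eq_iff)

lemma nrm_eq_0: "f \<in> H \<Longrightarrow> nrm f = 0 \<Longrightarrow> f = (\<lambda>_. 0)"
  using ip_definite[of f] ip_self[of f] by simp

lemma nrm_scale: "f \<in> H \<Longrightarrow> nrm (\<lambda>x. c * f x) = cmod c * nrm f"
proof -
  assume f: "f \<in> H"
  have "(nrm (\<lambda>x. c * f x))\<^sup>2 = Re (c * cnj c * ip f f)"
    by (simp add: nrm_sq f scale_mem ip_scale ip_scale_right mult_ac)
  also have "\<dots> = (cmod c * nrm f)\<^sup>2"
    by (simp add: ip_self[OF f] complex_norm_square[symmetric] power_mult_distrib del: of_real_power)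
  finally show ?thesis
    by (rule power2_eq_imp_eq) (auto intro!: nrm_ge_0 scale_mem f mult_nonneg_nonneg)
qed

lemma cauchy_schwarz:
  assumes f: "f \<in> H" and g: "g \<in> H"
  shows "cmod (ip f g) \<le> nrm f * nrm g"
proof (cases "nrm g = 0")
  case True
  then have "g = (\<lambda>_. 0)" by (rule nrm_eq_0[OF g])
  then show ?thesis
    using True ip_sym[OF zero_mem f] ip_zero[OF f] by simp
next
  case False
  define N where "N = (nrm g)\<^sup>2"
  have N: "N > 0" using False by (simp add: N_def)
  define a where "a = ip f g / N"
  have "0 \<le> Re (ip (\<lambda>x. f x - a * g x) (\<lambda>x. f x - a * g x))"
    by (intro ip_nonneg diff_mem scale_mem f g)
  also have "ip (\<lambda>x. f x - a * g x) (\<lambda>x. f x - a * g x) =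
      ip f f - a * cnj (ip f g) - cnj a * ip f g + a * cnj a * ip g g"
    by (simp add: f g diff_mem scale_mem ip_diff ip_diff_right ip_scale ip_scale_right ip_sym[of f g]
        algebra_simps)
  also have "\<dots> = (nrm f)\<^sup>2 - ip f g * cnj (ip f g) / N"
    using N by (simp add: ip_self f g a_def flip: N_def)
  also have "Re \<dots> = (nrm f)\<^sup>2 - (cmod (ip f g))\<^sup>2 / N"
    by (simp add: complex_mult_cnj cmod_power2)
  finally have "(cmod (ip f g))\<^sup>2 \<le> (nrm f * nrm g)\<^sup>2"
    using N by (simp add: field_simps N_def power_mult_distrib)
  then show ?thesis
    by (rule power2_le_imp_le) (simp add: nrm_ge_0 f g)
qed

lemma nrm_triangle:
  assumes f: "f \<in> H" and g: "g \<in> H"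
  shows "nrm (\<lambda>x. f x + g x) \<le> nrm f + nrm g"
proof -
  have "(nrm (\<lambda>x. f x + g x))\<^sup>2 = (nrm f)\<^sup>2 + (nrm g)\<^sup>2 + 2 * Re (ip f g)"
    by (simp add: nrm_sq f g add_mem ip_add ip_add_right ip_sym[of f g])
  also have "\<dots> \<le> (nrm f + nrm g)\<^sup>2"
    using order_trans[OF complex_Re_le_cmod cauchy_schwarz[OF f g]]
    by (simp add: power2_eq_square algebra_simps)
  finally show ?thesis
    by (rule power2_le_imp_le) (auto intro!: nrm_ge_0 add_nonneg_nonneg f g)
qed

lemma ip_tendsto:
  assumes u: "\<And>n. u n \<in> H" and f: "f \<in> H" and g: "g \<in> H"
    and lim: "(\<lambda>n. nrm (\<lambda>x. u n x - f x)) \<longlonglongrightarrow> 0"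
  shows "(\<lambda>n. ip (u n) g) \<longlonglongrightarrow> ip f g"
proof -
  have "(\<lambda>n. ip (u n) g - ip f g) \<longlonglongrightarrow> 0"
  proof (rule Lim_null_comparison)
    show "\<forall>\<^sub>F n in sequentially. cmod (ip (u n) g - ip f g) \<le> nrm (\<lambda>x. u n x - f x) * nrm g"
      using cauchy_schwarz[OF diff_mem[OF u f] g] by (simp add: ip_diff u f g)
    show "(\<lambda>n. nrm (\<lambda>x. u n x - f x) * nrm g) \<longlonglongrightarrow> 0"
      using tendsto_mult_right[OF lim, of "nrm g"] by simp
  qed
  then show ?thesis by (rule LIM_zero_cancel)
qed

text \<open>
  The Riesz representation theorem for a bounded linear functional on a subspace that need not be
  closed.  The functional is given by its graph \<open>R\<close>, which spares the proof that it is single-valued;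
  that follows from the bound.  The representing vector minimizes the quadratic functional
  \<open>\<parallel>p\<parallel>\<^sup>2 - 2 Re t\<close> over \<open>R\<close>: the parallelogram law makes every minimizing sequence a Cauchy sequence,
  and the variation in the direction of \<open>(q, t) \<in> R\<close> gives \<open>ip q f = t\<close> for its limit \<open>f\<close>.
\<close>

lemma riesz_relation:
  fixes R :: "(('a \<Rightarrow> complex) \<times> complex) set"
  assumes R_mem: "\<And>p t. (p, t) \<in> R \<Longrightarrow> p \<in> H"
    and R_zero: "((\<lambda>_. 0), 0) \<in> R"
    and R_add: "\<And>p s q t. (p, s) \<in> R \<Longrightarrow> (q, t) \<in> R \<Longrightarrow> ((\<lambda>x. p x + q x), s + t) \<in> R"
    and R_scale: "\<And>p t c. (p, t) \<in> R \<Longrightarrow> ((\<lambda>x. c * p x), c * t) \<in> R"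
    and bound: "\<And>p t. (p, t) \<in> R \<Longrightarrow> cmod t \<le> C * nrm p"
  shows "\<exists>f \<in> ip_closure H ip (fst ` R). \<forall>(p, t)\<in>R. ip p f = t"
proof -
  define J where "J = (\<lambda>(p, t :: complex). (nrm p)\<^sup>2 - 2 * Re t)"
  have below: "- C\<^sup>2 \<le> J r" if "r \<in> R" for r
  proof -
    obtain p t where r: "r = (p, t)" by fastforce
    have "Re t \<le> C * nrm p"
      using bound[of p t] that complex_Re_le_cmod[of t] r by auto
    moreover have "0 \<le> (nrm p - C)\<^sup>2" by simp
    ultimately show ?thesis by (simp add: J_def r power2_eq_square algebra_simps)
  qed
  define d where "d = Inf (J ` R)"
  have bdd: "bdd_below (J ` R)" using below by (intro bdd_belowI) auto
  have d_le: "d \<le> J r" if "r \<in> R" for r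
    unfolding d_def by (rule cInf_lower[OF _ bdd]) (use that in simp)
  have "\<exists>r\<in>R. J r < d + 1 / real (Suc n)" for n
    using cInf_lessD[of "J ` R" "d + 1 / real (Suc n)"] R_zero unfolding d_def by auto
  then have "\<exists>P. \<forall>n. P n \<in> R \<and> J (P n) < d + 1 / real (Suc n)"
    by (intro choice) blast
  then obtain P where P: "\<And>n. P n \<in> R" and JP: "\<And>n. J (P n) < d + 1 / real (Suc n)"
    by blast
  define u where "u = (\<lambda>n. fst (P n))"
  define s where "s = (\<lambda>n. snd (P n))"
  have us: "(u n, s n) \<in> R" for n using P by (simp add: u_def s_def)
  have u: "u n \<in> H" for n using R_mem[OF us] .
  have Jus: "(nrm (u n))\<^sup>2 - 2 * Re (s n) < d + 1 / real (Suc n)" for n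
    using JP[of n] by (simp add: J_def u_def s_def split_beta)
  \<comment> \<open>The midpoint of two members of \<open>R\<close> has value at least \<open>d\<close>; the parallelogram law turns this into
     a bound for their distance.\<close>
  have gap: "(nrm (\<lambda>x. u m x - u n x))\<^sup>2 \<le> 2 / real (Suc m) + 2 / real (Suc n)" for m n
  proof -
    have "d \<le> J ((\<lambda>x. 1/2 * (u m x + u n x)), 1/2 * (s m + s n))"
      by (intro d_le R_scale R_add us)
    also have "\<dots> = (nrm (\<lambda>x. u m x + u n x))\<^sup>2 / 4 - Re (s m) - Re (s n)"
      by (simp only: J_def split_conv nrm_scale[OF add_mem[OF u u]])
         (simp add: power_mult_distrib power2_eq_square norm_divide field_simps)
    finally have "4 * d \<le> (nrm (\<lambda>x. u m x + u n x))\<^sup>2 - 4 * Re (s m) - 4 * Re (s n)" by simp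
    moreover have "(nrm (\<lambda>x. u m x + u n x))\<^sup>2 + (nrm (\<lambda>x. u m x - u n x))\<^sup>2
        = 2 * (nrm (u m))\<^sup>2 + 2 * (nrm (u n))\<^sup>2"
      by (simp add: nrm_sq u add_mem diff_mem ip_add ip_add_right ip_diff ip_diff_right)
    ultimately show ?thesis using Jus[of m] Jus[of n] by simp
  qed
  have "\<exists>f\<in>H. (\<lambda>n. nrm (\<lambda>x. u n x - f x)) \<longlonglongrightarrow> 0"
  proof (rule complete[OF u])
    fix e :: real assume e: "0 < e"
    obtain N where N: "4 / e\<^sup>2 < real N" using reals_Archimedean2 by blast
    have "nrm (\<lambda>x. u m x - u n x) < e" if "N \<le> m" "N \<le> n" for m n
    proof -
      have "4 / real (Suc N) < e\<^sup>2"
        using N e by (simp add: field_simps)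
           (smt (verit) zero_less_power)
      moreover have "2 / real (Suc m) \<le> 2 / real (Suc N)" "2 / real (Suc n) \<le> 2 / real (Suc N)"
        using that by (auto intro!: divide_left_mono)
      ultimately have "(nrm (\<lambda>x. u m x - u n x))\<^sup>2 < e\<^sup>2" using gap[of m n] by simp
      then show ?thesis by (rule power2_less_imp_less) (use e in simp)
    qed
    then show "\<exists>N. \<forall>m\<ge>N. \<forall>n\<ge>N. nrm (\<lambda>x. u m x - u n x) < e" by blast
  qed
  then obtain f where f: "f \<in> H" and lim: "(\<lambda>n. nrm (\<lambda>x. u n x - f x)) \<longlonglongrightarrow> 0" by blast
  have "ip q f = t" if qt: "(q, t) \<in> R" for q t
  proof -
    have q: "q \<in> H" using R_mem[OF qt] .
    define e where "e = (\<lambda>n. ip q (u n) - t)"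
    define e' where "e' = ip q f - t"
    \<comment> \<open>Any step size \<open>a > 0\<close> with \<open>a \<parallel>q\<parallel>\<^sup>2 < 2\<close> makes the first variation dominate.\<close>
    define a where "a = 1 / ((nrm q)\<^sup>2 + 1)"
    have a: "a > 0" by (simp add: a_def add_nonneg_pos)
    have var: "- (1 / real (Suc n)) \<le> a\<^sup>2 * (cmod (e n))\<^sup>2 * (nrm q)\<^sup>2 - 2 * a * (cmod (e n))\<^sup>2" for n
    proof -
      define z where "z = - of_real a * cnj (e n)"
      have "d \<le> J ((\<lambda>x. u n x + z * q x), s n + z * t)"
        by (intro d_le R_add R_scale us qt)
      also have "\<dots> = (nrm (u n))\<^sup>2 - 2 * Re (s n) + (cmod z)\<^sup>2 * (nrm q)\<^sup>2 + 2 * Re (z * e n)"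
        by (simp add: J_def nrm_sq u q add_mem scale_mem ip_add ip_add_right ip_scale ip_scale_right
            ip_sym[of q "u n"] e_def algebra_simps cmod_power2)
           (simp add: ip_self[OF q] power2_eq_square algebra_simps)
      finally have "- (1 / real (Suc n)) \<le> (cmod z)\<^sup>2 * (nrm q)\<^sup>2 + 2 * Re (z * e n)"
        using Jus[of n] by simp
      also have "Re (z * e n) = - a * (cmod (e n))\<^sup>2"
        unfolding z_def cmod_power2 by (simp add: power2_eq_square algebra_simps)
      also have "(cmod z)\<^sup>2 = a\<^sup>2 * (cmod (e n))\<^sup>2"
        by (simp add: z_def norm_mult power_mult_distrib)
      finally show ?thesis by simp
    qed
    have "(\<lambda>n. cnj (ip (u n) q)) \<longlonglongrightarrow> cnj (ip f q)"
      by (intro tendsto_cnj ip_tendsto u f q lim)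
    then have "(\<lambda>n. ip q (u n)) \<longlonglongrightarrow> ip q f"
      by (simp add: ip_sym[of _ q, symmetric] u f q flip: ip_sym)
    then have el: "e \<longlonglongrightarrow> e'" unfolding e_def e'_def by (intro tendsto_intros)
    have "- 0 \<le> a\<^sup>2 * (cmod e')\<^sup>2 * (nrm q)\<^sup>2 - 2 * a * (cmod e')\<^sup>2"
    proof (rule LIMSEQ_le)
      show "(\<lambda>n. - (1 / real (Suc n))) \<longlonglongrightarrow> - 0"
        by (intro tendsto_minus LIMSEQ_Suc lim_1_over_n)
      show "(\<lambda>n. a\<^sup>2 * (cmod (e n))\<^sup>2 * (nrm q)\<^sup>2 - 2 * a * (cmod (e n))\<^sup>2)
        \<longlonglongrightarrow> a\<^sup>2 * (cmod e')\<^sup>2 * (nrm q)\<^sup>2 - 2 * a * (cmod e')\<^sup>2"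
        by (intro tendsto_intros el)
    qed (use var in blast)
    also have "\<dots> = a * (cmod e')\<^sup>2 * (a * (nrm q)\<^sup>2 - 2)"
      by (simp add: algebra_simps power2_eq_square)
    finally have "0 \<le> a * (cmod e')\<^sup>2 * (a * (nrm q)\<^sup>2 - 2)" by simp
    moreover have "a * (nrm q)\<^sup>2 - 2 < 0"
      by (simp add: a_def divide_less_eq add_nonneg_pos)
    ultimately have "a * (cmod e')\<^sup>2 \<le> 0"
      by (meson mult_pos_neg not_le)
    then have "e' = 0" using a by (simp add: mult_le_0_iff)
    then show ?thesis by (simp add: e'_def)
  qed
  moreover have "f \<in> ip_closure H ip (fst ` R)"
    unfolding ip_closure_def
  proof (intro CollectI conjI allI impI f)
    fix e :: real assume "0 < e"
    then obtain n where "nrm (\<lambda>x. u n x - f x) < e"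
      using order_tendstoD(2)[OF lim] by (auto simp: eventually_sequentially)
    moreover have "nrm (\<lambda>x. f x - u n x) = nrm (\<lambda>x. u n x - f x)"
      using nrm_scale[OF diff_mem[OF u f], of "-1" n] by simp
    ultimately show "\<exists>g\<in>fst ` R. nrm (\<lambda>x. f x - g x) < e"
      using us[of n] by (force intro!: bexI[of _ "u n"])
  qed
  ultimately show ?thesis by blast
qed


lemma nrm_diff_commute: "f \<in> H \<Longrightarrow> g \<in> H \<Longrightarrow> nrm (\<lambda>x. f x - g x) = nrm (\<lambda>x. g x - f x)"
  using nrm_scale[OF diff_mem[of f g], of "-1"] by simp

lemma weighted_series_converges_weakly:
  assumes u: "\<And>n. u n \<in> H" and u1: "\<And>n. nrm (u n) \<le> 1"
  shows "\<exists>s\<in>H. \<forall>g\<in>H. (\<lambda>n. (1/8)^n * ip (u n) g) sums ip s g"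
proof -
  define U where "U = (\<lambda>N x. \<Sum>k<N. (1/8)^k * u k x)"
  define S where "S = (\<lambda>N. \<Sum>k<N. (1/8::real)^k)"
  have U: "U N \<in> H" for N
    unfolding U_def by (intro sum_mem scale_mem u) simp
  have le: "nrm (\<lambda>x. U m x - U n x) \<le> S m - S n" if "n \<le> m" for m n
    using that
  proof (induction m rule: dec_induct)
    case base
    then show ?case by (simp add: ip_norm_def ip_zero zero_mem)
  next
    case (step m)
    have "(\<lambda>x. U (Suc m) x - U n x) = (\<lambda>x. (U m x - U n x) + (1/8)^m * u m x)"
      by (simp add: U_def fun_eq_iff)
    then have "nrm (\<lambda>x. U (Suc m) x - U n x)
        \<le> nrm (\<lambda>x. U m x - U n x) + nrm (\<lambda>x. (1/8)^m * u m x)"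
      using nrm_triangle[OF diff_mem[OF U U] scale_mem[OF u]] by simp
    moreover have "nrm (\<lambda>x. (1/8)^m * u m x) \<le> (1/8)^m"
      using mult_left_mono[OF u1[of m], of "(1/8)^m"]
      by (simp add: nrm_scale u norm_power norm_divide)
    ultimately show ?case using step.IH by (simp add: S_def)
  qed
  have le': "nrm (\<lambda>x. U m x - U n x) \<le> \<bar>S m - S n\<bar>" for m n
    using le[of n m] le[of m n] nrm_diff_commute[OF U U, of m n] by (cases "n \<le> m") auto
  have "Cauchy S"
    unfolding S_def by (intro convergent_Cauchy) (simp add: summable_iff_convergent[symmetric] summable_geometric)
  have "\<exists>s\<in>H. (\<lambda>n. nrm (\<lambda>x. U n x - s x)) \<longlonglongrightarrow> 0"
  proof (rule complete[OF U])
    fix e :: real assume "0 < e"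
    with \<open>Cauchy S\<close> obtain N where "\<And>m n. N \<le> m \<Longrightarrow> N \<le> n \<Longrightarrow> \<bar>S m - S n\<bar> < e"
      unfolding Cauchy_def dist_real_def by blast
    then show "\<exists>N. \<forall>m\<ge>N. \<forall>n\<ge>N. nrm (\<lambda>x. U m x - U n x) < e"
      using le' by (meson le_less_trans)
  qed
  then obtain s where s: "s \<in> H" and lim: "(\<lambda>n. nrm (\<lambda>x. U n x - s x)) \<longlonglongrightarrow> 0" by blast
  have "(\<lambda>n. (1/8)^n * ip (u n) g) sums ip s g" if g: "g \<in> H" for g
  proof -
    have "ip (U N) g = (\<Sum>k<N. (1/8)^k * ip (u k) g)" for N
      unfolding U_def using ip_sum[of "{..<N}" "\<lambda>k x. (1/8)^k * u k x" g]
      by (simp add: scale_mem u g ip_scale)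
    then show ?thesis
      using ip_tendsto[OF U s g lim] by (simp add: sums_def)
  qed
  with s show ?thesis by blast
qed

text \<open>
  The gliding hump for the functionals \<open>ip _ q\<close> and the unit vectors in the direction of \<open>q\<close>, at
  which they attain their norms.
\<close>

lemma uniform_boundedness:
  assumes QH: "Q \<subseteq> H" and weak: "\<And>f. f \<in> H \<Longrightarrow> \<exists>B. \<forall>q\<in>Q. cmod (ip f q) \<le> B"
  shows "\<exists>C. \<forall>q\<in>Q. nrm q \<le> C"
proof -
  \<comment> \<open>The zero vector has no direction and needs no bound.\<close>
  define I where "I = {q \<in> Q. nrm q \<noteq> 0}"
  define f where "f = (\<lambda>q x. complex_of_real (1 / nrm q) * q x)"
  have I: "q \<in> H" if "q \<in> I" for q using that QH by (auto simp: I_def)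
  have pos: "0 < nrm q" if "q \<in> I" for q
    using that nrm_ge_0[OF I[OF that]] by (simp add: I_def)
  have f: "f q \<in> H" if "q \<in> I" for q
    unfolding f_def by (intro scale_mem I that)
  have f1: "nrm (f q) = 1" if "q \<in> I" for q
    using pos[OF that] nrm_scale[OF I[OF that], of "complex_of_real (1 / nrm q)"]
    by (simp add: f_def norm_divide)
  have "\<exists>C. \<forall>q\<in>I. nrm q \<le> C"
  proof (rule gliding_hump[where A = "\<lambda>q r. ip (f r) q"])
    fix q assume q: "q \<in> I"
    show "cmod (ip (f r) q) \<le> nrm q" if "r \<in> I" for r
      using cauchy_schwarz[OF f[OF that] I[OF q]] f1[OF that] by simp
    have "ip (f q) q = nrm q"
      using pos[OF q] ip_scale[OF I[OF q] I[OF q], of "complex_of_real (1 / nrm q)"]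
      by (simp add: f_def I[OF q] ip_self power2_eq_square)
    then show "nrm q \<le> 4 * cmod (ip (f q) q)"
      using pos[OF q] by simp
    show "\<exists>B. \<forall>r\<in>I. cmod (ip (f q) r) \<le> B"
      using weak[OF f[OF q]] by (auto simp: I_def)
  next
    fix J :: "nat \<Rightarrow> 'a \<Rightarrow> complex" assume J: "\<And>n. J n \<in> I"
    obtain s where s: "s \<in> H" "\<And>g. g \<in> H \<Longrightarrow> (\<lambda>n. (1/8)^n * ip (f (J n)) g) sums ip s g"
      using weighted_series_converges_weakly[of "\<lambda>n. f (J n)"] f f1 J by (metis order_refl)
    show "\<exists>B. \<forall>i\<in>I. cmod (\<Sum>n. (1/8)^n * ip (f (J n)) i) \<le> B"
      using weak[OF s(1)] s(2)[OF I] by (auto simp: I_def sums_iff)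
  qed
  then obtain C where "\<And>q. q \<in> I \<Longrightarrow> nrm q \<le> C" by blast
  then have "\<forall>q\<in>Q. nrm q \<le> max 0 C"
    by (force simp: I_def le_max_iff_disj)
  then show ?thesis by blast
qed

section \<open>Interpolation of values on a subset\<close>

definition kernel_at :: "'a \<Rightarrow> 'a \<Rightarrow> complex" where
  "kernel_at y = restrict_to X (\<lambda>x. K x y)"

definition kernel_comb :: "'a set \<Rightarrow> ('a \<Rightarrow> complex) \<Rightarrow> 'a \<Rightarrow> complex" where
  "kernel_comb T c = (\<lambda>x. \<Sum>y\<in>T. c y * kernel_at y x)"

lemma kernel_at_mem: "y \<in> X \<Longrightarrow> kernel_at y \<in> H"
  by (simp add: kernel_at_def kernel_mem)

lemma ip_kernel_at: "f \<in> H \<Longrightarrow> y \<in> X \<Longrightarrow> ip f (kernel_at y) = f y"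
  by (simp add: kernel_at_def reproducing)

lemma kernel_comb_mem: "finite T \<Longrightarrow> T \<subseteq> X \<Longrightarrow> kernel_comb T c \<in> H"
  unfolding kernel_comb_def by (intro sum_mem scale_mem kernel_at_mem) auto

lemma ip_kernel_comb:
  "finite T \<Longrightarrow> T \<subseteq> X \<Longrightarrow> f \<in> H \<Longrightarrow> ip f (kernel_comb T c) = (\<Sum>y\<in>T. cnj (c y) * f y)"
  unfolding kernel_comb_def
  by (subst ip_sum_right) (auto intro!: sum.cong scale_mem kernel_at_mem simp: ip_scale_right kernel_at_mem ip_kernel_at subset_iff)

lemma nrm_kernel_comb_sq:
  assumes "finite T" "T \<subseteq> X"
  shows "(nrm (kernel_comb T c))\<^sup>2 = Re (\<Sum>x\<in>T. \<Sum>y\<in>T. cnj (c x) * c y * K x y)"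
proof -
  have "ip (kernel_comb T c) (kernel_comb T c) = (\<Sum>x\<in>T. cnj (c x) * kernel_comb T c x)"
    by (intro ip_kernel_comb kernel_comb_mem assms)
  also have "\<dots> = (\<Sum>x\<in>T. \<Sum>y\<in>T. cnj (c x) * c y * K x y)"
    using assms by (intro sum.cong) (auto simp: kernel_comb_def kernel_at_def restrict_to_def sum_distrib_left mult.assoc)
  finally show ?thesis using assms by (simp add: nrm_sq kernel_comb_mem)
qed

lemma kernel_comb_scale: "kernel_comb T (\<lambda>y. a * c y) = (\<lambda>x. a * kernel_comb T c x)"
  by (simp add: kernel_comb_def sum_distrib_left mult.assoc)

lemma kernel_comb_plus: "kernel_comb T (\<lambda>y. c y + d y) = (\<lambda>x. kernel_comb T c x + kernel_comb T d x)"
  by (simp add: kernel_comb_def distrib_right sum.distrib)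

definition kernel_span_on :: "'a set \<Rightarrow> ('a \<Rightarrow> complex) set" where
  "kernel_span_on Y = {f. \<exists>T c. finite T \<and> T \<subseteq> Y \<and> f = kernel_comb T c}"

text \<open>
  If \<open>f\<close> takes the values \<open>v\<close> on \<open>Y\<close>, then \<open>ip _ f\<close> maps the combination of kernel functions with
  coefficients \<open>c\<close> to \<open>\<Sum>y. c y * cnj (v y)\<close>.  Conversely, when this prescription is bounded, the Riesz
  representation theorem provides \<open>f\<close>.
\<close>

lemma interpolation:
  assumes Y: "Y \<subseteq> X"
    and bound: "\<And>T c. finite T \<Longrightarrow> T \<subseteq> Y \<Longrightarrow>
                  cmod (\<Sum>y\<in>T. c y * cnj (v y)) \<le> C * nrm (kernel_comb T c)"
  shows "\<exists>f \<in> ip_closure H ip (kernel_span_on Y). \<forall>y\<in>Y. f y = v y"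
proof -
  define R where "R = {r. \<exists>T c. finite T \<and> T \<subseteq> Y \<and> r = (kernel_comb T c, \<Sum>y\<in>T. c y * cnj (v y))}"
  have "\<exists>f \<in> ip_closure H ip (fst ` R). \<forall>(p, t)\<in>R. ip p f = t"
  proof (rule riesz_relation)
    show "((\<lambda>_. 0), 0) \<in> R"
      unfolding R_def by (intro CollectI exI[of _ "{}"] exI) (auto simp: kernel_comb_def)
    show "p \<in> H" if "(p, t) \<in> R" for p t
      using that Y by (auto simp: R_def intro!: kernel_comb_mem)
    show "cmod t \<le> C * nrm p" if "(p, t) \<in> R" for p t
      using that bound by (auto simp: R_def)
    show "((\<lambda>x. a * p x), a * t) \<in> R" if pt: "(p, t) \<in> R" for p t a
    proof -
      obtain T c where *: "finite T" "T \<subseteq> Y" "p = kernel_comb T c" "t = (\<Sum>y\<in>T. c y * cnj (v y))"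
        using pt by (auto simp: R_def)
      show ?thesis unfolding R_def
        by (intro CollectI exI[of _ T] exI[of _ "\<lambda>y. a * c y"])
           (use * in \<open>auto simp: kernel_comb_scale sum_distrib_left mult.assoc\<close>)
    qed
    show "((\<lambda>x. p x + q x), s + t) \<in> R" if ps: "(p, s) \<in> R" and qt: "(q, t) \<in> R" for p s q t
    proof -
      obtain S c where 1: "finite S" "S \<subseteq> Y" "p = kernel_comb S c" "s = (\<Sum>y\<in>S. c y * cnj (v y))"
        using ps by (auto simp: R_def)
      obtain T d where 2: "finite T" "T \<subseteq> Y" "q = kernel_comb T d" "t = (\<Sum>y\<in>T. d y * cnj (v y))"
        using qt by (auto simp: R_def)
      show ?thesis unfolding R_def
        by (intro CollectI exI[of _ "S \<union> T"]
              exI[of _ "\<lambda>y. (if y \<in> S then c y else 0) + (if y \<in> T then d y else 0)"])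
           (use 1 2 in \<open>auto simp: kernel_comb_def sum_union_zero_extended\<close>)
    qed
  qed
  moreover have "fst ` R = kernel_span_on Y"
    unfolding R_def kernel_span_on_def image_def by fastforce
  ultimately obtain f where f: "f \<in> ip_closure H ip (kernel_span_on Y)"
    and "\<forall>(p, t)\<in>R. ip p f = t" by auto
  then have fR: "ip p f = t" if "(p, t) \<in> R" for p t using that by auto
  have fH: "f \<in> H" using f by (simp add: ip_closure_def)
  have "f y = v y" if y: "y \<in> Y" for y
  proof -
    have "(kernel_at y, cnj (v y)) \<in> R"
      unfolding R_def
      by (intro CollectI exI[of _ "{y}"] exI[of _ "\<lambda>_. 1"]) (use y in \<open>auto simp: kernel_comb_def\<close>)
    then have "ip (kernel_at y) f = cnj (v y)" by (rule fR)
    then show ?thesis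
      using ip_sym[OF fH kernel_at_mem[of y]] ip_kernel_at[OF fH, of y] y Y by auto
  qed
  with f show ?thesis by blast
qed

text \<open>
  The restriction of \<open>g \<in> H\<close> to \<open>Y\<close> only depends on the orthogonal projection of \<open>g\<close> to the closed
  span of the kernel functions at \<open>Y\<close>; the projection is obtained by interpolating the values of \<open>g\<close>.
\<close>

lemma restrict_closure_kernel_span:
  assumes Y: "Y \<subseteq> X"
  shows "restrict_to Y ` ip_closure H ip (kernel_span_on Y) = restrict_to Y ` H"
proof
  show "restrict_to Y ` ip_closure H ip (kernel_span_on Y) \<subseteq> restrict_to Y ` H"
    by (auto simp: ip_closure_def)
  show "restrict_to Y ` H \<subseteq> restrict_to Y ` ip_closure H ip (kernel_span_on Y)"
  proof
    fix h assume "h \<in> restrict_to Y ` H"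
    then obtain g where g: "g \<in> H" and h: "h = restrict_to Y g" by blast
    have "\<exists>f \<in> ip_closure H ip (kernel_span_on Y). \<forall>y\<in>Y. f y = g y"
    proof (rule interpolation[OF Y])
      fix T :: "'a set" and c assume T: "finite T" "T \<subseteq> Y"
      then have TX: "T \<subseteq> X" using Y by blast
      have "(\<Sum>y\<in>T. c y * cnj (g y)) = cnj (ip g (kernel_comb T c))"
        by (simp add: ip_kernel_comb T TX g)
      also have "cmod \<dots> \<le> nrm g * nrm (kernel_comb T c)"
        using cauchy_schwarz[OF g kernel_comb_mem[OF T(1) TX]] by simp
      finally show "cmod (\<Sum>y\<in>T. c y * cnj (g y)) \<le> nrm g * nrm (kernel_comb T c)" .
    qed
    then obtain f where f: "f \<in> ip_closure H ip (kernel_span_on Y)" "\<forall>y\<in>Y. f y = g y" by blast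
    then have "h = restrict_to Y f" by (simp add: h restrict_to_def fun_eq_iff)
    with f(1) show "h \<in> restrict_to Y ` ip_closure H ip (kernel_span_on Y)" by blast
  qed
qed

section \<open>Multipliers as functions with bounded adjoint\<close>

text \<open>
  Multiplication by \<open>g\<close> has an adjoint that acts on kernel functions by \<open>k\<^sub>y \<mapsto> cnj (g y) k\<^sub>y\<close>.
  Restricted to points of \<open>Y\<close>, its boundedness by \<open>C\<close> is a condition on finite sums, equivalent to
  positivity of the kernel \<open>(C\<^sup>2 - g x * cnj (g y)) * K x y\<close> on \<open>Y\<close> when \<open>0 \<le> C\<close>.
\<close>

definition adjoint_bounded :: "'a set \<Rightarrow> real \<Rightarrow> ('a \<Rightarrow> complex) \<Rightarrow> bool" where
  "adjoint_bounded Y C g \<longleftrightarrow>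
     (\<forall>T c. finite T \<longrightarrow> T \<subseteq> Y \<longrightarrow> nrm (kernel_comb T (\<lambda>y. cnj (g y) * c y)) \<le> C * nrm (kernel_comb T c))"

text \<open>
  The product \<open>g f\<close> is interpolated: \<open>\<Sum>y. c y * cnj (g y * f y)\<close> is the conjugate of the inner
  product of \<open>f\<close> with the image of \<open>\<Sum>y. c y * k\<^sub>y\<close> under the adjoint.
\<close>

lemma adjoint_bounded_multiplies:
  assumes Y: "Y \<subseteq> X" and g: "adjoint_bounded Y C g" and f: "f \<in> H"
  shows "\<exists>f'\<in>H. \<forall>y\<in>Y. f' y = g y * f y"
proof -
  have "\<exists>f' \<in> ip_closure H ip (kernel_span_on Y). \<forall>y\<in>Y. f' y = g y * f y"
  proof (rule interpolation[OF Y])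
    fix T :: "'a set" and c assume T: "finite T" "T \<subseteq> Y"
    then have TX: "T \<subseteq> X" using Y by blast
    let ?q = "kernel_comb T (\<lambda>y. cnj (g y) * c y)"
    have "(\<Sum>y\<in>T. c y * cnj (g y * f y)) = cnj (ip f ?q)"
      by (simp add: ip_kernel_comb T TX f mult_ac)
    also have "cmod \<dots> \<le> nrm f * nrm ?q"
      using cauchy_schwarz[OF f kernel_comb_mem[OF T(1) TX]] by simp
    also have "\<dots> \<le> nrm f * (C * nrm (kernel_comb T c))"
      using g T by (intro mult_left_mono nrm_ge_0 f) (auto simp: adjoint_bounded_def)
    finally show "cmod (\<Sum>y\<in>T. c y * cnj (g y * f y)) \<le> (nrm f * C) * nrm (kernel_comb T c)"
      by (simp add: mult.assoc)
  qed
  then show ?thesis by (auto simp: ip_closure_def)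
qed

text \<open>
  If \<open>f' = g f\<close> on \<open>Y\<close>, then pairing \<open>f\<close> with the image of \<open>p\<close> under the adjoint is pairing \<open>f'\<close> with \<open>p\<close>.  The
  images of combinations of norm at most \<open>1\<close> are thus weakly bounded, and uniform boundedness applies.
\<close>

lemma multiplies_adjoint_bounded:
  assumes Y: "Y \<subseteq> X" and mult: "\<And>f. f \<in> H \<Longrightarrow> \<exists>f'\<in>H. \<forall>y\<in>Y. f' y = g y * f y"
  shows "\<exists>C\<ge>0. adjoint_bounded Y C g"
proof -
  define q where "q = (\<lambda>T c. kernel_comb T (\<lambda>y. cnj (g y) * c y))"
  define Q where "Q = {r. \<exists>T c. finite T \<and> T \<subseteq> Y \<and> nrm (kernel_comb T c) \<le> 1 \<and> r = q T c}"
  have qH: "q T c \<in> H" if "finite T" "T \<subseteq> Y" for T c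
    unfolding q_def using that Y by (intro kernel_comb_mem) auto
  have transfer: "\<exists>f'\<in>H. \<forall>T c. finite T \<longrightarrow> T \<subseteq> Y \<longrightarrow> ip f (q T c) = ip f' (kernel_comb T c)"
    if f: "f \<in> H" for f
  proof -
    obtain f' where f': "f' \<in> H" "\<And>y. y \<in> Y \<Longrightarrow> f' y = g y * f y" using mult[OF f] by blast
    have "ip f (q T c) = ip f' (kernel_comb T c)" if "finite T" "T \<subseteq> Y" for T c
      using that Y f f' by (auto simp: q_def ip_kernel_comb intro!: sum.cong)
    with f' show ?thesis by blast
  qed
  have "\<exists>C. \<forall>r\<in>Q. nrm r \<le> C"
  proof (rule uniform_boundedness)
    show "Q \<subseteq> H" using qH by (auto simp: Q_def)
    fix f assume "f \<in> H"
    then obtain f' where f': "f' \<in> H" "\<And>T c. finite T \<Longrightarrow> T \<subseteq> Y \<Longrightarrow> ip f (q T c) = ip f' (kernel_comb T c)"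
      using transfer by blast
    have "cmod (ip f r) \<le> nrm f'" if rQ: "r \<in> Q" for r
    proof -
      obtain T c where r: "finite T" "T \<subseteq> Y" "nrm (kernel_comb T c) \<le> 1" "r = q T c"
        using rQ unfolding Q_def mem_Collect_eq by metis
      have "T \<subseteq> X" using r(2) Y by blast
      then have "cmod (ip f r) \<le> nrm f' * nrm (kernel_comb T c)"
        unfolding r(4) f'(2)[OF r(1,2)] by (intro cauchy_schwarz f'(1) kernel_comb_mem r(1))
      also have "\<dots> \<le> nrm f' * 1"
        by (intro mult_left_mono nrm_ge_0 f'(1) r(3))
      finally show ?thesis by simp
    qed
    then show "\<exists>B. \<forall>r\<in>Q. cmod (ip f r) \<le> B" by blast
  qed
  then obtain C where C: "\<And>r. r \<in> Q \<Longrightarrow> nrm r \<le> C" by blast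
  have "nrm (q T c) \<le> max 0 C * nrm (kernel_comb T c)" if T: "finite T" "T \<subseteq> Y" for T c
  proof -
    have p: "kernel_comb T c \<in> H" using T Y by (intro kernel_comb_mem) auto
    show ?thesis
    proof (cases "nrm (kernel_comb T c) = 0")
      case True
      \<comment> \<open>Normalizing is impossible here, but pairing \<open>q T c\<close> with itself is pairing some vector with \<open>0\<close>.\<close>
      then have "kernel_comb T c = (\<lambda>_. 0)" by (rule nrm_eq_0[OF p])
      moreover obtain f' where "f' \<in> H" "ip (q T c) (q T c) = ip f' (kernel_comb T c)"
        using transfer[OF qH[OF T]] T by metis
      ultimately have "ip (q T c) (q T c) = 0"
        using cauchy_schwarz[OF \<open>f' \<in> H\<close> p] True by simp
      then have "nrm (q T c) = 0" by (simp add: ip_norm_def)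
      then show ?thesis using True by simp
    next
      case False
      define b where "b = complex_of_real (1 / nrm (kernel_comb T c))"
      have pos: "0 < nrm (kernel_comb T c)" using False nrm_ge_0[OF p] by simp
      have "q T (\<lambda>y. b * c y) = (\<lambda>x. b * q T c x)"
        unfolding q_def by (subst kernel_comb_scale[symmetric]) (simp add: mult_ac)
      moreover have "nrm (kernel_comb T (\<lambda>y. b * c y)) \<le> 1"
        using pos unfolding kernel_comb_scale nrm_scale[OF p] by (simp add: b_def norm_divide)
      then have "q T (\<lambda>y. b * c y) \<in> Q"
        unfolding Q_def using T by blast
      ultimately have "nrm (\<lambda>x. b * q T c x) \<le> C" using C by metis
      then have "nrm (q T c) / nrm (kernel_comb T c) \<le> C"
        using pos unfolding nrm_scale[OF qH[OF T]] by (simp add: b_def norm_divide)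
      then have "nrm (q T c) \<le> C * nrm (kernel_comb T c)"
        using pos by (simp add: pos_divide_le_eq)
      also have "\<dots> \<le> max 0 C * nrm (kernel_comb T c)"
        using pos by (intro mult_right_mono) auto
      finally show ?thesis .
    qed
  qed
  then show ?thesis
    by (intro exI[of _ "max 0 C"]) (auto simp: adjoint_bounded_def q_def)
qed

lemma multipliers_restriction_iff:
  assumes Y: "Y \<subseteq> X"
  shows "g \<in> multipliers Y (restrict_to Y ` H) \<longleftrightarrow> g \<in> funs_on Y \<and> (\<exists>C\<ge>0. adjoint_bounded Y C g)"
proof -
  have eq: "(\<lambda>x. g x * restrict_to Y f x) \<in> restrict_to Y ` H
      \<longleftrightarrow> (\<exists>f'\<in>H. \<forall>y\<in>Y. f' y = g y * f y)" for f
  proof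
    assume "(\<lambda>x. g x * restrict_to Y f x) \<in> restrict_to Y ` H"
    then obtain f' where f': "f' \<in> H" "(\<lambda>x. g x * restrict_to Y f x) = restrict_to Y f'" by blast
    have "f' y = g y * f y" if "y \<in> Y" for y
      using fun_cong[OF f'(2), of y] that by (simp add: restrict_to_def)
    with f'(1) show "\<exists>f'\<in>H. \<forall>y\<in>Y. f' y = g y * f y" by blast
  next
    assume "\<exists>f'\<in>H. \<forall>y\<in>Y. f' y = g y * f y"
    then obtain f' where f': "f' \<in> H" "\<forall>y\<in>Y. f' y = g y * f y" by blast
    then have "(\<lambda>x. g x * restrict_to Y f x) = restrict_to Y f'"
      by (simp add: restrict_to_def fun_eq_iff)
    with f'(1) show "(\<lambda>x. g x * restrict_to Y f x) \<in> restrict_to Y ` H" by blast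
  qed
  show ?thesis
    unfolding multipliers_def
    using adjoint_bounded_multiplies[OF Y] multiplies_adjoint_bounded[OF Y, of g]
    by (auto simp: eq)
qed

text \<open>
  The values of \<open>g\<close> are conjugates of eigenvalues of the adjoint.
\<close>

lemma adjoint_bounded_le:
  assumes "Y \<subseteq> X" and g: "adjoint_bounded Y C g" and z: "z \<in> Y" and pos: "0 < Re (K z z)"
  shows "cmod (g z) \<le> C"
proof -
  have zX: "z \<in> X" using assms by auto
  have "ip (kernel_at z) (kernel_at z) = K z z"
    using zX by (simp add: ip_kernel_at kernel_at_mem) (simp add: kernel_at_def restrict_to_def)
  then have "(nrm (kernel_at z))\<^sup>2 > 0" using pos by (simp add: nrm_sq kernel_at_mem zX)
  then have "nrm (kernel_at z) > 0" using nrm_ge_0[OF kernel_at_mem[OF zX]] by (auto simp: less_le)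
  moreover have "nrm (\<lambda>x. cnj (g z) * kernel_at z x) \<le> C * nrm (kernel_at z)"
    using g[unfolded adjoint_bounded_def, rule_format, of "{z}" "\<lambda>_. 1"] z by (simp add: kernel_comb_def)
  ultimately show ?thesis by (simp add: nrm_scale kernel_at_mem zX)
qed

text \<open>
  Let \<open>p\<close> be the component of \<open>k\<^sub>y\<close> orthogonal to \<open>k\<^sub>x\<close>, of norm \<open>d \<parallel>k\<^sub>y\<parallel>\<close>, and \<open>q\<close> its image under the adjoint.
  Then \<open>\<langle>q, k\<^sub>x\<rangle> = K x y * cnj (g y - g x)\<close>, and the bound \<open>\<parallel>q\<parallel> \<le> C \<parallel>p\<parallel>\<close> yields
  \<open>sqrt (1 - d\<^sup>2) \<bar>g x - g y\<bar> \<le> C d\<close>.  This is the claim for \<open>d < 1/2\<close>; for larger \<open>d\<close> the bound \<open>\<bar>g\<bar> \<le> C\<close> suffices.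
\<close>

lemma adjoint_bounded_lipschitz:
  assumes Y: "Y \<subseteq> X" and g: "adjoint_bounded Y C g" and C: "0 \<le> C"
    and xy: "x \<in> Y" "y \<in> Y" and pos: "0 < Re (K x x)" "0 < Re (K y y)"
    and d: "0 \<le> d" "d\<^sup>2 = 1 - (cmod (K x y))\<^sup>2 / (Re (K x x) * Re (K y y))"
  shows "cmod (g x - g y) \<le> 4 * C * d"
proof (cases "x = y")
  case True
  then show ?thesis using C d(1) by simp
next
  case False
  have X: "x \<in> X" "y \<in> X" using xy Y by auto
  define N where "N = (\<lambda>z. Re (K z z))"
  have N_fold: "Re (K z z) = N z" for z by (simp add: N_def)
  have kernel_at_app: "kernel_at w z = K z w" if "z \<in> X" for z w
    using that by (simp add: kernel_at_def restrict_to_def)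
  have N: "(nrm (kernel_at z))\<^sup>2 = N z" "K z z = N z" if "z \<in> X" for z
  proof -
    have "ip (kernel_at z) (kernel_at z) = K z z" using that by (simp add: ip_kernel_at kernel_at_mem kernel_at_app)
    then show *: "(nrm (kernel_at z))\<^sup>2 = N z"
      by (simp add: nrm_sq kernel_at_mem that N_def)
    show "K z z = N z"
      using ip_self[OF kernel_at_mem[OF that]] \<open>ip (kernel_at z) (kernel_at z) = K z z\<close> * by metis
  qed
  have Npos: "0 < N x" "0 < N y" using pos by (auto simp: N_def)
  have Ksym: "K y x = cnj (K x y)"
    using ip_sym[OF kernel_at_mem[OF X(1)] kernel_at_mem[OF X(2)]] X by (simp add: ip_kernel_at kernel_at_mem kernel_at_app)
  define a where "a = K x y / N x"
  define c where "c = (\<lambda>z. if z = y then 1 else - a)"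
  define p where "p = kernel_comb {x, y} c"
  define q where "q = kernel_comb {x, y} (\<lambda>z. cnj (g z) * c z)"
  have pH: "p \<in> H" and qH: "q \<in> H" unfolding p_def q_def using X by (auto intro!: kernel_comb_mem)
  have p: "p z = kernel_at y z - a * kernel_at x z" for z
    unfolding p_def kernel_comb_def c_def using False by simp
  have q: "q z = cnj (g y) * kernel_at y z - cnj (g x) * a * kernel_at x z" for z
    unfolding q_def kernel_comb_def c_def using False by simp
  have px: "p x = 0"
    using Npos X by (simp add: p kernel_at_app N a_def)
  have "p y = N y - (cmod (K x y))\<^sup>2 / N x"
    using X by (simp add: p kernel_at_app N a_def Ksym complex_norm_square del: of_real_power)
  also have "\<dots> = N y * d\<^sup>2"
    using Npos by (simp add: d(2) N_fold field_simps)
  finally have py: "p y = N y * d\<^sup>2" .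
  have "ip p (kernel_comb {x, y} c) = p y"
    using X pH px False by (simp add: ip_kernel_comb) (simp add: c_def)
  then have "ip p p = p y" by (simp only: p_def[symmetric])
  then have "(nrm p)\<^sup>2 = (sqrt (N y) * d)\<^sup>2"
    using Npos by (simp add: nrm_sq pH py power_mult_distrib)
  then have np: "nrm p = sqrt (N y) * d"
    by (rule power2_eq_imp_eq) (use pH d Npos in \<open>auto intro: nrm_ge_0\<close>)
  have nkx: "nrm (kernel_at x) = sqrt (N x)"
    by (rule real_sqrt_unique[symmetric]) (use N(1)[OF X(1)] nrm_ge_0[OF kernel_at_mem[OF X(1)]] in auto)
  have "ip q (kernel_at x) = K x y * cnj (g y - g x)"
    using Npos X by (simp add: ip_kernel_at qH q kernel_at_app N a_def algebra_simps)
  then have "cmod (K x y) * cmod (g x - g y) \<le> nrm q * sqrt (N x)"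
    using cauchy_schwarz[OF qH kernel_at_mem[OF X(1)]] 
    by (simp add: nkx norm_mult norm_minus_commute flip: complex_cnj_diff)
  also have "\<dots> \<le> (C * nrm p) * sqrt (N x)"
    using g xy Npos by (intro mult_right_mono) (auto simp: adjoint_bounded_def p_def q_def)
  also have "\<dots> = C * d * sqrt (N x * N y)"
    by (simp add: np real_sqrt_mult)
  finally have est: "cmod (K x y) * cmod (g x - g y) \<le> C * d * sqrt (N x * N y)" .
  show ?thesis
  proof (cases "d \<ge> 1/2")
    case True
    have "cmod (g x - g y) \<le> C + C"
      using adjoint_bounded_le[OF Y g] xy pos norm_triangle_ineq4[of "g x" "g y"] by (meson add_mono order_trans)
    also have "\<dots> \<le> 4 * C * d"
      using mult_left_mono[OF True C] by simp
    finally show ?thesis .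
  next
    case False
    have "d\<^sup>2 \<le> 1/4"
      using False d power_mono[of d "1/2" 2] by (simp add: power2_eq_square)
    have "(cmod (K x y))\<^sup>2 = (1 - d\<^sup>2) * (N x * N y)"
      using Npos by (simp add: d(2) N_fold)
    also have "\<dots> \<ge> (1/4) * (N x * N y)"
      using \<open>d\<^sup>2 \<le> 1/4\<close> Npos by (intro mult_right_mono) auto
    finally have "(sqrt (N x * N y) / 2)\<^sup>2 \<le> (cmod (K x y))\<^sup>2"
      using Npos by (simp add: power_divide)
    then have half: "sqrt (N x * N y) / 2 \<le> cmod (K x y)"
      by (rule power2_le_imp_le) simp
    have "sqrt (N x * N y) / 2 * cmod (g x - g y) \<le> C * d * sqrt (N x * N y)"
      using est mult_right_mono[OF half, of "cmod (g x - g y)"] by simp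
    then have "cmod (g x - g y) \<le> 2 * C * d"
      using Npos by (simp add: field_simps)
    also have "\<dots> \<le> 4 * C * d" using C d by simp
    finally show ?thesis .
  qed
qed

lemma kernel_comb_cong: "(\<And>y. y \<in> T \<Longrightarrow> c y = d y) \<Longrightarrow> kernel_comb T c = kernel_comb T d"
  by (simp add: kernel_comb_def fun_eq_iff)

lemma adjoint_bounded_mono: "adjoint_bounded Y C g \<Longrightarrow> Z \<subseteq> Y \<Longrightarrow> adjoint_bounded Z C g"
  by (auto simp: adjoint_bounded_def)

lemma adjoint_bounded_cong:
  assumes "\<And>y. y \<in> Y \<Longrightarrow> g y = h y"
  shows "adjoint_bounded Y C g = adjoint_bounded Y C h"
proof -
  have "kernel_comb T (\<lambda>y. cnj (g y) * c y) = kernel_comb T (\<lambda>y. cnj (h y) * c y)" if "T \<subseteq> Y" for T c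
    using that assms by (intro kernel_comb_cong) auto
  then show ?thesis by (auto simp: adjoint_bounded_def)
qed

lemma adjoint_bounded_geometric_sum:
  assumes Y: "Y \<subseteq> X" and h: "\<And>k. adjoint_bounded Y 1 (h k)"
  shows "adjoint_bounded Y (\<Sum>k<N. (1/8)^k) (\<lambda>y. \<Sum>k<N. (1/8)^k * h k y)"
  unfolding adjoint_bounded_def
proof (intro allI impI)
  fix T c assume T: "finite T" "T \<subseteq> Y"
  have TX: "T \<subseteq> X" using T Y by blast
  note mem = kernel_comb_mem[OF T(1) TX]
  show "nrm (kernel_comb T (\<lambda>y. cnj (\<Sum>k<N. (1/8)^k * h k y) * c y)) \<le> (\<Sum>k<N. (1/8)^k) * nrm (kernel_comb T c)"
  proof (induction N)
    case 0
    then show ?case by (simp add: kernel_comb_def ip_norm_def ip_zero zero_mem)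
  next
    case (Suc N)
    let ?p = "kernel_comb T (\<lambda>y. cnj (\<Sum>k<N. (1/8)^k * h k y) * c y)"
    let ?q = "kernel_comb T (\<lambda>y. cnj (h N y) * c y)"
    have "kernel_comb T (\<lambda>y. cnj (\<Sum>k<Suc N. (1/8)^k * h k y) * c y)
        = kernel_comb T (\<lambda>y. cnj (\<Sum>k<N. (1/8)^k * h k y) * c y + (1/8)^N * (cnj (h N y) * c y))"
      by (rule kernel_comb_cong) (simp add: algebra_simps)
    also have "\<dots> = (\<lambda>x. ?p x + (1/8)^N * ?q x)"
      by (simp only: kernel_comb_plus kernel_comb_scale)
    finally have eq: "kernel_comb T (\<lambda>y. cnj (\<Sum>k<Suc N. (1/8)^k * h k y) * c y)
        = (\<lambda>x. ?p x + (1/8)^N * ?q x)" .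
    have "nrm (\<lambda>x. ?p x + (1/8)^N * ?q x) \<le> nrm ?p + nrm (\<lambda>x. (1/8)^N * ?q x)"
      by (intro nrm_triangle mem scale_mem)
    also have "nrm (\<lambda>x. (1/8)^N * ?q x) = (1/8)^N * nrm ?q"
      by (subst nrm_scale[OF mem]) (simp add: norm_power norm_divide)
    also have "nrm ?p + \<dots> \<le> (\<Sum>k<N. (1/8)^k) * nrm (kernel_comb T c) + (1/8)^N * nrm (kernel_comb T c)"
      using h[of N] T by (intro add_mono mult_left_mono Suc.IH) (auto simp: adjoint_bounded_def)
    finally show ?case unfolding eq by (simp add: distrib_right)
  qed
qed

text \<open>
  For a fixed finite set of points the norms depend continuously on the values of the symbol.
\<close>

lemma adjoint_bounded_limit:
  assumes Y: "Y \<subseteq> X" and h: "\<And>N. adjoint_bounded Y C (h N)"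
    and lim: "\<And>y. y \<in> Y \<Longrightarrow> (\<lambda>N. h N y) \<longlonglongrightarrow> s y"
  shows "adjoint_bounded Y C s"
  unfolding adjoint_bounded_def
proof (intro allI impI)
  fix T c assume T: "finite T" "T \<subseteq> Y"
  have TX: "T \<subseteq> X" using T Y by blast
  note mem = kernel_comb_mem[OF T(1) TX]
  have le: "nrm (kernel_comb T (\<lambda>y. cnj (h N y) * c y)) \<le> C * nrm (kernel_comb T c)" for N
    using h T by (auto simp: adjoint_bounded_def)
  have C0: "0 \<le> C * nrm (kernel_comb T c)"
    using nrm_ge_0[OF mem] le[of 0] order_trans by blast
  have "(\<lambda>N. (nrm (kernel_comb T (\<lambda>y. cnj (h N y) * c y)))\<^sup>2) \<longlonglongrightarrow> (nrm (kernel_comb T (\<lambda>y. cnj (s y) * c y)))\<^sup>2"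
    unfolding nrm_kernel_comb_sq[OF T(1) TX]
    by (intro tendsto_intros tendsto_sum lim subsetD[OF T(2)])
  then have "(nrm (kernel_comb T (\<lambda>y. cnj (s y) * c y)))\<^sup>2 \<le> (C * nrm (kernel_comb T c))\<^sup>2"
    by (rule Lim_bounded) (intro allI impI power_mono le nrm_ge_0 mem)
  then show "nrm (kernel_comb T (\<lambda>y. cnj (s y) * c y)) \<le> C * nrm (kernel_comb T c)"
    by (rule power2_le_imp_le) (rule C0)
qed

lemma adjoint_bounded_geometric_series:
  assumes Y: "Y \<subseteq> X" and pos: "\<And>y. y \<in> Y \<Longrightarrow> 0 < Re (K y y)"
    and h: "\<And>k. adjoint_bounded Y 1 (h k)"
  shows "\<exists>s. adjoint_bounded Y 2 s \<and> (\<forall>y\<in>Y. (\<lambda>k. (1/8)^k * h k y) sums s y)"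
proof -
  define s where "s = (\<lambda>y. \<Sum>k. (1/8)^k * h k y)"
  have sums: "(\<lambda>k. (1/8)^k * h k y) sums s y" if y: "y \<in> Y" for y
    unfolding s_def
  proof (rule summable_sums, rule summable_norm_cancel, rule summable_comparison_test')
    show "summable (\<lambda>k. (1/8::real)^k)" by (intro summable_geometric) simp
    show "norm (norm ((1/8)^k * h k y)) \<le> (1/8)^k" for k
      using mult_left_mono[OF adjoint_bounded_le[OF Y h y pos[OF y]], of "(1/8)^k" k]
      by (simp add: norm_mult norm_power norm_divide)
  qed
  \<comment> \<open>The constant \<open>2\<close> is \<open>8/7\<close> rounded up.\<close>
  have geo: "(\<Sum>k<N. (1/8::real)^k) \<le> 2" for N
  proof -
    have "(\<Sum>k<N. (1/8::real)^k) \<le> (\<Sum>k. (1/8)^k)"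
      by (intro sum_le_suminf summable_geometric) auto
    then show ?thesis by (simp add: suminf_geometric)
  qed
  have "adjoint_bounded Y 2 (\<lambda>y. \<Sum>k<N. (1/8)^k * h k y)" for N
    unfolding adjoint_bounded_def
  proof (intro allI impI)
    fix T c assume T: "finite T" "T \<subseteq> Y"
    have "nrm (kernel_comb T (\<lambda>y. cnj (\<Sum>k<N. (1/8)^k * h k y) * c y)) \<le> (\<Sum>k<N. (1/8)^k) * nrm (kernel_comb T c)"
      using adjoint_bounded_geometric_sum[OF Y h, of N] T by (auto simp: adjoint_bounded_def)
    also have "\<dots> \<le> 2 * nrm (kernel_comb T c)"
      using T Y by (intro mult_right_mono geo nrm_ge_0 kernel_comb_mem) auto
    finally show "nrm (kernel_comb T (\<lambda>y. cnj (\<Sum>k<N. (1/8)^k * h k y) * c y)) \<le> 2 * nrm (kernel_comb T c)" .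
  qed
  then have "adjoint_bounded Y 2 s"
    by (rule adjoint_bounded_limit[OF Y]) (use sums in \<open>simp add: sums_def\<close>)
  with sums show ?thesis by blast
qed

end

section \<open>Multipliers of the Drury-Arveson space\<close>

locale drury_arveson_space = rkhs "ball 0 1" da_kernel H ip
  for H :: "('i ell2 \<Rightarrow> complex) set" and ip
begin

lemma multiplier_lipschitz:
  assumes Y: "Y \<subseteq> ball 0 1" and g: "adjoint_bounded Y C g" "0 \<le> C" and xy: "x \<in> Y" "y \<in> Y"
  shows "cmod (g x - g y) \<le> 4 * C * pseudohyperbolic x y"
proof (rule adjoint_bounded_lipschitz[OF Y g xy])
  have "x \<in> ball 0 1" "y \<in> ball 0 1" using xy Y by blast+
  then show "0 < Re (da_kernel x x)" "0 < Re (da_kernel y y)"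
    "(pseudohyperbolic x y)\<^sup>2 =
      1 - (cmod (da_kernel x y))\<^sup>2 / (Re (da_kernel x x) * Re (da_kernel y y))"
    by (intro da_kernel_diag_pos pseudohyperbolic_sq; simp)+
  show "0 \<le> pseudohyperbolic x y" by (simp add: pseudohyperbolic_def)
qed

text \<open>
  The kernel \<open>(1 - h x * cnj (h y)) * da_kernel x y\<close> is positive semidefinite because it is the sum of two such kernels.
  The first is \<open>1 - cinner (\<phi> x) (\<phi> y)\<close> times the Drury-Arveson kernel, where \<open>\<phi>\<close> is the
  automorphism: there the factor \<open>1 - cinner x y\<close> cancels and leaves rank one.  The second is
  the Gram kernel of \<open>\<psi> = \<phi> - h e\<close>, the part of \<open>\<phi>\<close> orthogonal to \<open>e\<close>, times the
  Drury-Arveson kernel, a Schur product.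
\<close>

lemma automorphism_component_contractive:
  assumes a: "a \<in> ball 0 1" and e: "norm e = 1"
  shows "adjoint_bounded (ball 0 1) 1 (\<lambda>z. cinner (ball_automorphism a z) e)"
  unfolding adjoint_bounded_def
proof (intro allI impI)
  fix T :: "'i ell2 set" and c assume T: "finite T" "T \<subseteq> ball 0 1"
  define h where "h = (\<lambda>z. cinner (ball_automorphism a z) e)"
  define \<psi> where "\<psi> = (\<lambda>z. ball_automorphism a z - h z *\<^sub>C e)"
  define b where "b = (\<lambda>z. 1 / (1 - cinner z a))"
  let ?S = "\<lambda>M. \<Sum>x\<in>T. \<Sum>y\<in>T. cnj (c x) * c y * M x y :: complex"
  have ee: "cinner e e = 1" by (simp add: cinner_self e)
  have \<psi>: "cinner (\<psi> x) (\<psi> y)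
      = cinner (ball_automorphism a x) (ball_automorphism a y) - h x * cnj (h y)" for x y
    using cinner_commute[of e "ball_automorphism a y"]
    by (simp add: \<psi>_def cinner_diff_left cinner_diff_right cinner_scaleC_left cinner_scaleC_right ee
        h_def[symmetric] fun_cong[OF h_def, symmetric])
  have split: "(1 - h x * cnj (h y)) * da_kernel x y
      = (1 - (norm a)\<^sup>2) * b x * cnj (b y) + cinner (\<psi> x) (\<psi> y) * da_kernel x y"
    if "x \<in> T" "y \<in> T" for x y
  proof -
    have xy: "x \<in> ball 0 1" "y \<in> ball 0 1" using that T by blast+
    have nz: "1 - cinner x y \<noteq> 0" by (rule cinner_ball_neq_1[OF xy])
    have "(1 - cinner (ball_automorphism a x) (ball_automorphism a y)) * da_kernel x y
        = (1 - (norm a)\<^sup>2) * b x * cnj (b y)"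
      unfolding cinner_ball_automorphism[OF xy a] da_kernel_def b_def
      using nz by (simp add: cinner_commute[of y a])
    then show ?thesis by (simp add: \<psi> algebra_simps)
  qed
  have "?S (\<lambda>x y. (1 - h x * cnj (h y)) * da_kernel x y)
      = ?S (\<lambda>x y. (1 - (norm a)\<^sup>2) * b x * cnj (b y) + cinner (\<psi> x) (\<psi> y) * da_kernel x y)"
    by (intro sum.cong refl) (simp only: split)
  also have "\<dots> = ?S (\<lambda>x y. (1 - (norm a)\<^sup>2) * b x * cnj (b y)) + ?S (\<lambda>x y. cinner (\<psi> x) (\<psi> y) * da_kernel x y)"
    by (simp add: distrib_left sum.distrib)
  also have "?S (\<lambda>x y. (1 - (norm a)\<^sup>2) * b x * cnj (b y))
      = (1 - (norm a)\<^sup>2) * ((\<Sum>x\<in>T. cnj (c x) * b x) * (\<Sum>y\<in>T. c y * cnj (b y)))"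
    unfolding sum_product by (simp add: sum_distrib_left mult_ac)
  also have "(\<Sum>y\<in>T. c y * cnj (b y)) = cnj (\<Sum>x\<in>T. cnj (c x) * b x)" by simp
  also have "(\<Sum>x\<in>T. cnj (c x) * b x) * cnj (\<Sum>x\<in>T. cnj (c x) * b x)
      = complex_of_real ((cmod (\<Sum>x\<in>T. cnj (c x) * b x))\<^sup>2)"
    by (rule complex_norm_square[symmetric])
  finally have "Re (?S (\<lambda>x y. (1 - h x * cnj (h y)) * da_kernel x y))
      = (1 - (norm a)\<^sup>2) * (cmod (\<Sum>x\<in>T. cnj (c x) * b x))\<^sup>2
        + Re (?S (\<lambda>x y. cinner (\<psi> x) (\<psi> y) * da_kernel x y))"
    by simp
  moreover have "0 \<le> Re (?S (\<lambda>x y. cinner (\<psi> x) (\<psi> y) * da_kernel x y))"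
  proof (rule schur_product_gram)
    fix c show "0 \<le> Re (\<Sum>x\<in>T. \<Sum>y\<in>T. cnj (c x) * c y * da_kernel x y)"
      unfolding nrm_kernel_comb_sq[OF T, symmetric] by simp
  qed
  moreover have "0 \<le> 1 - (norm a)\<^sup>2" using a by (simp add: power_le_one)
  ultimately have nonneg: "0 \<le> Re (?S (\<lambda>x y. (1 - h x * cnj (h y)) * da_kernel x y))"
    by simp
  have "?S (\<lambda>x y. (1 - h x * cnj (h y)) * da_kernel x y) = ?S da_kernel
      - (\<Sum>x\<in>T. \<Sum>y\<in>T. cnj (cnj (h x) * c x) * (cnj (h y) * c y) * da_kernel x y)"
    by (simp add: sum_subtractf[symmetric] algebra_simps)
  with nonneg have "(nrm (kernel_comb T (\<lambda>y. cnj (h y) * c y)))\<^sup>2 \<le> (nrm (kernel_comb T c))\<^sup>2"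
    by (simp only: nrm_kernel_comb_sq[OF T]) simp
  then show "nrm (kernel_comb T (\<lambda>y. cnj (cinner (ball_automorphism a y) e) * c y)) \<le> 1 * nrm (kernel_comb T c)"
    unfolding h_def mult_1 by (rule power2_le_imp_le) (intro nrm_ge_0 kernel_comb_mem T)
qed

text \<open>
  The automorphism that moves \<open>b\<close> to \<open>0\<close> moves \<open>a\<close> to a vector \<open>u\<close> of norm \<open>\<delta>(a,b)\<close>; its component in the
  direction of \<open>u\<close> has the values \<open>0\<close> and \<open>\<delta>(a,b)\<close> at these points.
\<close>

lemma separating_contraction:
  assumes a: "a \<in> ball 0 1" and b: "b \<in> ball 0 1"
  shows "\<exists>h. adjoint_bounded (ball 0 1) 1 h \<and> cmod (h a - h b) = pseudohyperbolic a b"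
proof (cases "pseudohyperbolic a b = 0")
  case True
  have "adjoint_bounded (ball 0 1) 1 (\<lambda>_. 0)"
    unfolding adjoint_bounded_def
    by (auto simp: kernel_comb_def[of _ "\<lambda>_. 0"] ip_norm_def[of ip "\<lambda>_. 0"] ip_zero zero_mem intro!: nrm_ge_0 kernel_comb_mem)
  then show ?thesis using True by (intro exI[of _ "\<lambda>_. 0"]) simp
next
  case False
  define u where "u = ball_automorphism b a"
  have u: "norm u = pseudohyperbolic a b" by (simp add: u_def pseudohyperbolic_def)
  define e where "e = complex_of_real (1 / norm u) *\<^sub>C u"
  have e: "norm e = 1" using False unfolding u[symmetric] by (simp add: e_def norm_scaleC norm_divide)
  have "(cmod (da_kernel b b))\<^sup>2 = Re (da_kernel b b) * Re (da_kernel b b)"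
    unfolding da_kernel_diag norm_of_real by (simp add: power2_eq_square)
  then have "(pseudohyperbolic b b)\<^sup>2 = 0"
    using pseudohyperbolic_sq[OF b b] da_kernel_diag_pos[OF b] by simp
  then have "ball_automorphism b b = 0" by (simp add: pseudohyperbolic_def)
  then have "cinner (ball_automorphism b b) e = 0"
    using cinner_diff_left[of 0 0 e] by simp
  moreover have "cinner u e = norm u"
    using False by (simp add: e_def cinner_scaleC_right cinner_self u power2_eq_square)
  ultimately show ?thesis
    using automorphism_component_contractive[OF b e] u norm_ge_zero[of u, unfolded u]
    by (intro exI[of _ "\<lambda>z. cinner (ball_automorphism b z) e"]) (simp add: u_def)
qed

text \<open>
  The gliding hump is applied to the difference quotients \<open>\<Delta> i k = (k (F \<xi>) - k (F \<mu>)) / \<delta>(\<xi>,\<mu>)\<close>, indexed by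
  pairs \<open>i = (\<xi>, \<mu>)\<close>, at the contractions \<open>h i\<close> that separate \<open>F \<xi>\<close> from \<open>F \<mu>\<close>.  Columns and series are bounded
  because each \<open>h j\<close> and each sum \<open>\<Sum>\<^sub>n 8\<^sup>-\<^sup>n h (J n)\<close> is a multiplier, so that its composition with \<open>F\<close> is a
  multiplier on \<open>W\<close> and hence Lipschitz.
\<close>

lemma composition_pseudohyperbolic_lipschitz:
  assumes V: "V \<subseteq> ball 0 1" and W: "W \<subseteq> ball 0 1" and F: "\<And>x. x \<in> W \<Longrightarrow> F x \<in> V"
    and comp: "\<And>h. h \<in> multipliers V (restrict_to V ` H) \<Longrightarrow>
                 \<exists>g \<in> multipliers W (restrict_to W ` H). \<forall>x\<in>W. g x = h (F x)"
  shows "\<exists>C>0. \<forall>\<xi>\<in>W. \<forall>\<mu>\<in>W. pseudohyperbolic (F \<xi>) (F \<mu>) \<le> C * pseudohyperbolic \<xi> \<mu>"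
proof -
  let ?\<delta> = "pseudohyperbolic :: 'i ell2 \<Rightarrow> 'i ell2 \<Rightarrow> real"
  have \<delta>0: "0 \<le> ?\<delta> x y" for x y by (simp add: pseudohyperbolic_def)
  have FB: "F x \<in> ball 0 1" if "x \<in> W" for x using F[OF that] V by blast
  have pulled_back: "\<exists>L\<ge>0. \<forall>\<xi>\<in>W. \<forall>\<mu>\<in>W. cmod (h (F \<xi>) - h (F \<mu>)) \<le> L * ?\<delta> \<xi> \<mu>"
    if h: "adjoint_bounded (ball 0 1) C h" and C: "0 \<le> C" for h C
  proof -
    have "adjoint_bounded V C (restrict_to V h)"
      using adjoint_bounded_mono[OF h V] adjoint_bounded_cong[of V "restrict_to V h" h C]
      by (simp add: restrict_to_def)
    moreover have "restrict_to V h \<in> funs_on V"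
      by (simp add: funs_on_def restrict_to_def)
    ultimately have "restrict_to V h \<in> multipliers V (restrict_to V ` H)"
      using C multipliers_restriction_iff[OF V] by blast
    from comp[OF this] obtain g where g: "g \<in> multipliers W (restrict_to W ` H)"
      and "\<forall>x\<in>W. g x = restrict_to V h (F x)" by blast
    then have gh: "g x = h (F x)" if "x \<in> W" for x
      using that F[OF that] by (simp add: restrict_to_def)
    obtain D where D: "0 \<le> D" "adjoint_bounded W D g"
      using g by (auto simp: multipliers_restriction_iff[OF W])
    then show ?thesis
      using multiplier_lipschitz[OF W D(2,1)] by (intro exI[of _ "4 * D"]) (simp flip: gh)
  qed
  define I where "I = W \<times> W"
  have "\<exists>h. adjoint_bounded (ball 0 1) 1 h \<and>
      cmod (h (F (fst i)) - h (F (snd i))) = ?\<delta> (F (fst i)) (F (snd i))" if "i \<in> I" for i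
    using that by (intro separating_contraction FB) (auto simp: I_def)
  then obtain h where h: "\<And>i. i \<in> I \<Longrightarrow> adjoint_bounded (ball 0 1) 1 (h i)"
    and hi: "\<And>i. i \<in> I \<Longrightarrow>
      cmod (h i (F (fst i)) - h i (F (snd i))) = ?\<delta> (F (fst i)) (F (snd i))"
    by metis
  define d where "d = (\<lambda>i. ?\<delta> (fst i) (snd i))"
  define D where "D = (\<lambda>i. ?\<delta> (F (fst i)) (F (snd i)))"
  \<comment> \<open>At pairs of distance \<open>0\<close> the division by zero yields \<open>0\<close>, and all conditions on such an index hold trivially.\<close>
  define \<Delta> where "\<Delta> = (\<lambda>i k. (k (F (fst i)) - k (F (snd i))) / complex_of_real (d i) :: complex)"
  have d0: "0 \<le> d i" for i by (simp add: d_def \<delta>0)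
  have norm_\<Delta>: "cmod (\<Delta> i k) = cmod (k (F (fst i)) - k (F (snd i))) / d i" for i k
    using d0[of i] by (simp add: \<Delta>_def norm_divide)
  have "\<exists>C. \<forall>i\<in>I. 4 * (D i / d i) \<le> C"
  proof (rule gliding_hump[where A = "\<lambda>i j. \<Delta> i (h j)"])
    fix i assume i: "i \<in> I"
    then have iW: "fst i \<in> W" "snd i \<in> W" by (auto simp: I_def)
    show "cmod (\<Delta> i (h j)) \<le> 4 * (D i / d i)" if "j \<in> I" for j
      using divide_right_mono[OF multiplier_lipschitz[OF order_refl h[OF that] _ FB[OF iW(1)] FB[OF iW(2)]] d0[of i]]
      by (simp add: norm_\<Delta> D_def)
    show "4 * (D i / d i) \<le> 4 * cmod (\<Delta> i (h i))"
      by (simp add: norm_\<Delta> hi[OF i] D_def)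
  next
    fix j assume "j \<in> I"
    from pulled_back[OF h[OF this] zero_le_one]
    obtain L where L: "0 \<le> L" "\<And>\<xi> \<mu>. \<xi> \<in> W \<Longrightarrow> \<mu> \<in> W \<Longrightarrow>
        cmod (h j (F \<xi>) - h j (F \<mu>)) \<le> L * ?\<delta> \<xi> \<mu>"
      by blast
    have "cmod (\<Delta> i (h j)) \<le> L" if "i \<in> I" for i
      using L(2)[of "fst i" "snd i"] that L(1) d0[of i]
      by (cases "d i = 0") (auto simp: norm_\<Delta> I_def d_def pos_divide_le_eq less_le)
    then show "\<exists>B. \<forall>i\<in>I. cmod (\<Delta> i (h j)) \<le> B" by blast
  next
    fix J :: "nat \<Rightarrow> 'i ell2 \<times> 'i ell2" assume J: "\<And>n. J n \<in> I"
    obtain s where s: "adjoint_bounded (ball 0 1) 2 s"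
      and sums: "\<And>y. y \<in> ball 0 1 \<Longrightarrow> (\<lambda>n. (1/8)^n * h (J n) y) sums s y"
      using adjoint_bounded_geometric_series[OF order_refl da_kernel_diag_pos, of "\<lambda>n. h (J n)"] h J
      by blast
    obtain L where L: "0 \<le> L" "\<And>\<xi> \<mu>. \<xi> \<in> W \<Longrightarrow> \<mu> \<in> W \<Longrightarrow>
        cmod (s (F \<xi>) - s (F \<mu>)) \<le> L * ?\<delta> \<xi> \<mu>"
      using pulled_back[OF s zero_le_numeral] by blast
    have "cmod (\<Sum>n. (1/8)^n * \<Delta> i (h (J n))) \<le> L" if i: "i \<in> I" for i
    proof -
      have iW: "fst i \<in> W" "snd i \<in> W" using i by (auto simp: I_def)
      have "(\<lambda>n. ((1/8)^n * h (J n) (F (fst i)) - (1/8)^n * h (J n) (F (snd i))) / complex_of_real (d i))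
          sums \<Delta> i s"
        unfolding \<Delta>_def by (intro sums_divide sums_diff sums FB iW)
      then have "(\<lambda>n. (1/8)^n * \<Delta> i (h (J n))) sums \<Delta> i s"
        by (simp add: \<Delta>_def right_diff_distrib)
      then have "(\<Sum>n. (1/8)^n * \<Delta> i (h (J n))) = \<Delta> i s" by (simp add: sums_iff)
      moreover have "cmod (\<Delta> i s) \<le> L"
        using L(2)[OF iW] L(1) d0[of i]
        by (cases "d i = 0") (auto simp: norm_\<Delta> d_def pos_divide_le_eq less_le)
      ultimately show ?thesis by simp
    qed
    then show "\<exists>B. \<forall>i\<in>I. cmod (\<Sum>n. (1/8)^n * \<Delta> i (h (J n))) \<le> B" by blast
  qed
  then obtain C where C: "\<And>i. i \<in> I \<Longrightarrow> 4 * (D i / d i) \<le> C" by blast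
  have "?\<delta> (F \<xi>) (F \<mu>) \<le> (\<bar>C\<bar> + 1) * ?\<delta> \<xi> \<mu>" if "\<xi> \<in> W" "\<mu> \<in> W" for \<xi> \<mu>
  proof -
    let ?i = "(\<xi>, \<mu>)"
    have i: "?i \<in> I" using that by (simp add: I_def)
    show ?thesis
    proof (cases "?\<delta> \<xi> \<mu> = 0")
      case True
      obtain L where L: "\<forall>\<xi>\<in>W. \<forall>\<mu>\<in>W. cmod (h ?i (F \<xi>) - h ?i (F \<mu>)) \<le> L * ?\<delta> \<xi> \<mu>"
        using pulled_back[OF h[OF i] zero_le_one] by blast
      have "cmod (h ?i (F \<xi>) - h ?i (F \<mu>)) \<le> L * ?\<delta> \<xi> \<mu>"
        by (rule L[rule_format, OF that])
      then have "?\<delta> (F \<xi>) (F \<mu>) \<le> 0" using hi[OF i] True by simp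
      then show ?thesis by (simp add: True)
    next
      case False
      then have pos: "0 < ?\<delta> \<xi> \<mu>" using \<delta>0[of \<xi> \<mu>] by simp
      have "?\<delta> (F \<xi>) (F \<mu>) / ?\<delta> \<xi> \<mu> \<le> \<bar>C\<bar> + 1"
        using C[OF i] \<delta>0[of "F \<xi>" "F \<mu>"] pos by (simp add: D_def d_def)
      then show ?thesis using pos by (simp add: pos_divide_le_eq)
    qed
  qed
  then show ?thesis by (intro exI[of _ "\<bar>C\<bar> + 1"]) auto
qed

lemma M_var_eq_multipliers: "V \<subseteq> ball 0 1 \<Longrightarrow> M_var H ip V = multipliers V (restrict_to V ` H)"
proof -
  assume V: "V \<subseteq> ball 0 1"
  have "kernel_span V = kernel_span_on V"
    by (simp add: kernel_span_def kernel_span_on_def kernel_comb_def kernel_at_def)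
  then show ?thesis by (simp add: M_var_def H_var_def restrict_closure_kernel_span[OF V])
qed

end

section \<open>Isomorphisms induced by biholomorphisms\<close>

theorem theorem6p2:
  fixes H :: "('i::countable ell2 \<Rightarrow> complex) set"
    and ip :: "('i ell2 \<Rightarrow> complex) \<Rightarrow> ('i ell2 \<Rightarrow> complex) \<Rightarrow> complex"
    and V W :: "'i ell2 set"
    and \<phi> :: "('i ell2 \<Rightarrow> complex) \<Rightarrow> ('i ell2 \<Rightarrow> complex)"
    and F :: "'i ell2 \<Rightarrow> 'i ell2"
  assumes "drury_arveson H ip"
    and "variety H V" and "variety H W"
    and "algebra_iso (M_var H ip V) (M_var H ip W) \<phi>"
    and "biholomorphism F W V"
    and "\<forall>h \<in> M_var H ip V. \<forall>x \<in> W. \<phi> h x = h (F x)"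
  shows "\<exists>c C. c > 0 \<and> C > 0 \<and>
           (\<forall>\<xi> \<in> W. \<forall>\<mu> \<in> W.
              c * pseudohyperbolic \<xi> \<mu> \<le> pseudohyperbolic (F \<xi>) (F \<mu>) \<and>
              pseudohyperbolic (F \<xi>) (F \<mu>) \<le> C * pseudohyperbolic \<xi> \<mu>)"
proof -
  interpret drury_arveson_space H ip
    using assms(1) by (simp add: drury_arveson_space_def drury_arveson_def)
  have V: "V \<subseteq> ball 0 1" and W: "W \<subseteq> ball 0 1"
    using assms(2,3) by (auto simp: variety_def)
  note M = M_var_eq_multipliers[OF V] M_var_eq_multipliers[OF W]
  have \<phi>: "bij_betw \<phi> (M_var H ip V) (M_var H ip W)"
    using assms(4) by (simp add: algebra_iso_def)
  have F: "bij_betw F W V" using assms(5) by (simp add: biholomorphism_def)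
  define G where "G = inv_into W F"
  have FV: "F x \<in> V" "G (F x) = x" if "x \<in> W" for x
    using that F by (auto simp: G_def bij_betw_def)
  have GW: "G v \<in> W" "F (G v) = v" if "v \<in> V" for v
    using that F by (auto simp: G_def bij_betw_def inv_into_into f_inv_into_f)
  have "\<exists>C>0. \<forall>\<xi>\<in>W. \<forall>\<mu>\<in>W. pseudohyperbolic (F \<xi>) (F \<mu>) \<le> C * pseudohyperbolic \<xi> \<mu>"
  proof (rule composition_pseudohyperbolic_lipschitz[OF V W FV(1)])
    fix h assume "h \<in> multipliers V (restrict_to V ` H)"
    then have "h \<in> M_var H ip V" by (simp add: M)
    then have "\<phi> h \<in> M_var H ip W" "\<forall>x\<in>W. \<phi> h x = h (F x)"
      using \<phi> assms(6) by (auto simp: bij_betw_def)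
    then show "\<exists>g \<in> multipliers W (restrict_to W ` H). \<forall>x\<in>W. g x = h (F x)"
      unfolding M by blast
  qed
  then obtain C where C: "C > 0"
    "\<And>\<xi> \<mu>. \<xi> \<in> W \<Longrightarrow> \<mu> \<in> W \<Longrightarrow> pseudohyperbolic (F \<xi>) (F \<mu>) \<le> C * pseudohyperbolic \<xi> \<mu>"
    by blast
  have "\<exists>B>0. \<forall>v\<in>V. \<forall>w\<in>V. pseudohyperbolic (G v) (G w) \<le> B * pseudohyperbolic v w"
  proof (rule composition_pseudohyperbolic_lipschitz[OF W V GW(1)])
    fix g assume "g \<in> multipliers W (restrict_to W ` H)"
    then have "g \<in> M_var H ip W" by (simp add: M)
    then obtain h where h: "h \<in> M_var H ip V" "g = \<phi> h"
      using \<phi> by (auto simp: bij_betw_def)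
    have "h v = g (G v)" if "v \<in> V" for v
      using assms(6) h GW[OF that] by simp
    then show "\<exists>h \<in> multipliers V (restrict_to V ` H). \<forall>v\<in>V. h v = g (G v)"
      using h(1) unfolding M by blast
  qed
  then obtain B where B: "B > 0"
    "\<And>v w. v \<in> V \<Longrightarrow> w \<in> V \<Longrightarrow> pseudohyperbolic (G v) (G w) \<le> B * pseudohyperbolic v w"
    by blast
  have "1 / B * pseudohyperbolic \<xi> \<mu> \<le> pseudohyperbolic (F \<xi>) (F \<mu>)" if "\<xi> \<in> W" "\<mu> \<in> W" for \<xi> \<mu>
    using B(2)[of "F \<xi>" "F \<mu>"] B(1) FV that by (simp add: field_simps)
  then show ?thesis
    using B(1) C by (intro exI[of _ "1 / B"] exI[of _ C]) auto
qed

end
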